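(* Let $T:=\mathbb{Z}$, let $(\Omega,\mathcal{F},P)$ be a probability space, and let $X:T\times\Omega\to\mathbb{R}^n$ be a (discrete-time) stochastic process. Let $\phi$ be an STL formula (not necessarily bounded) built from the strict non-matching until operators. Then for each fixed $t\in T$ the maps $\omega\mapsto\beta^\phi(X(\cdot,\omega),t)$, $\omega\mapsto\mathrm{RD}^\phi(X(\cdot,\omega),t)$ and $\omega\mapsto\rho^\phi(X(\cdot,\omega),t)$ are measurable, i.e., $\beta^\phi(X,t)$, $\mathrm{RD}^\phi(X,t)$ and $\rho^\phi(X,t)$ are random variables.
   Context: Stochastic process: a function $X:T\times\Omega\to\mathbb{R}^n$ such that $X(t,\cdot)$ is a measurable map $\Omega\to\mathbb{R}^n$ (Borel $\sigma$-algebra on $\mathbb{R}^n$) for each $t\in T$. $\mathfrak{F}(A,B)$ denotes the set of measurable functions $A\to B$; a signal is an element $x\in\mathfrak{F}(T,\mathbb{R}^n)$. STL syntax. $\mathbb{B}:=\{\top,\bot\}$ with $\top:=1$, $\bot:=-1$ (so $\neg\top=\bot$, $\neg\bot=\top$). A predicate is a function $\mu:\mathbb{R}^n\to\mathbb{B}$ with $O^\mu:=\mu^{-1}(\top)$ and $O^{\neg\mu}:=\mathbb{R}^n\setminus O^\mu$; both sets are assumed nonempty and Borel measurable. STL formulas are generated by $$\phi ::= \top \mid \mu \mid \neg\phi \mid \phi'\wedge\phi'' \mid \phi' U_I\phi'' \mid \phi'\underline{U}_I\phi''$$ with time intervals $I\subseteq\mathbb{R}_{\ge0}$. Notation: $t\oplus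 I=\{t+s: s\in I\}$, $t\ominus I=\{t-s:s\in I\}$. $d:\mathbb{R}^n\times\mathbb{R}^n\to[0,\infty]$ is a metric on $\mathbb{R}^n$ (e.g. Euclidean), $\bar d(\zeta,S):=\inf_{\zeta'\in S}d(\zeta,\zeta')$, and $\mathrm{cl}$ is closure. Suprema and infima of extended-real quantities are extended ($\sup\emptyset=-\infty$, $\inf\emptyset=\infty$); those of $\mathbb{B}$-valued quantities are taken in the ordered set $\mathbb{B}$. Semantics $\beta^\phi(x,t)\in\mathbb{B}$: $\beta^\top(x,t)=\top$; $\beta^\mu(x,t)=\top$ if $x(t)\in O^\mu$ and $\bot$ otherwise; $\beta^{\neg\phi}=\neg\beta^\phi$; $\beta^{\phi'\wedge\phi''}=\min(\beta^{\phi'},\beta^{\phi''})$; $\beta^{\phi'U_I\phi''}(x,t)=\sup_{t''\in(t\oplus I)\cap T}\min\big(\beta^{\phi''}(x,t''),\inf_{t'\in(t,t'')\cap T}\beta^{\phi'}(x,t')\big)$; $\beta^{\phi'\underline U_I\phi''}(x,t)=\sup_{t''\in(t\ominus I)\cap T}\min\big(\beta^{\phi''}(x,t''),\inf_{t'\in(t'',t)\cap T}\beta^{\phi'}(x,t')\big)$. Robust semantics $\rho^\phi(x,t)\in[-\infty,\infty]$: $\rho^\top(x,t)=\infty$; $\rho^\mu(x,t)=\bar d(x(t),\mathrm{cl}(O^{\neg\mu}))$ if $x(t)\in O^\mu$ and $\rho^\mu(x,t)=-\bar d(x(t),\mathrm{cl}(O^{\mu}))$ otherwise; $\rho^{\neg\phi}=-\rho^\phi$;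 $\rho^{\phi'\wedge\phi''}=\min(\rho^{\phi'},\rho^{\phi''})$; and the until operators are given by the same sup/min/inf formulas as for $\beta$, with $\rho$ in place of $\beta$. Robustness degree: $\kappa(x,x'):=\sup_{t\in T}d(x(t),x'(t))$; $\mathcal{L}^{\neg\phi}(t):=\{x\in\mathfrak{F}(T,\mathbb{R}^n):\beta^{\neg\phi}(x,t)=\top\}$; $\mathrm{RD}^\phi(x,t):=\inf_{x'\in\mathrm{cl}(\mathcal{L}^{\neg\phi}(t))}\kappa(x,x')\in[0,\infty]$, the closure being with respect to $\kappa$. Measurability of $\beta^\phi$ is with respect to the power set of $\mathbb{B}$; measurability of $\rho^\phi$ and $\mathrm{RD}^\phi$ is with respect to the Borel $\sigma$-algebra of the extended reals.
   Formalization: The metric d on R^n is additionally assumed to have only Borel d-open sets (true for Euclidean distance and any metric inducing the usual topology); for arbitrary metrics the claim fails, e.g. d(x,y)=|f(x)-f(y)| with f injective and |f-f(0)| not Borel. *)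

theory Defs
  imports "HOL-Probability.Probability"
begin

text \<open>
  Time is the set of integers, so a signal with values in the state space \<open>'a\<close> has type
  \<open>int \<Rightarrow> 'a\<close>. The truth values are \<^typ>\<open>bool\<close> with its order \<open>False < True\<close>, under which
  \<open>min\<close>, \<open>SUP\<close> and \<open>INF\<close> on \<^typ>\<open>bool\<close> are the operations of the two-element chain
  (so \<open>SUP\<close> over the empty set is \<open>False\<close> and \<open>INF\<close> over it is \<open>True\<close>).
\<close>

datatype 'a stl =
    Truth
  | Pred "'a \<Rightarrow> bool"
  | Neg "'a stl"
  | Conj "'a stl" "'a stl"
  | Until "real set" "'a stl" "'a stl"
  | Since "real set" "'a stl" "'a stl"

definition time_interval :: "real set \<Rightarrow> bool" where
  "time_interval I \<longleftrightarrow> is_interval I \<and> I \<subseteq> {0..}"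

definition pred_set :: "('a \<Rightarrow> bool) \<Rightarrow> 'a set" where
  "pred_set \<mu> = {z. \<mu> z}"

definition admissible_pred :: "('a::topological_space \<Rightarrow> bool) \<Rightarrow> bool" where
  "admissible_pred \<mu> \<longleftrightarrow>
     pred_set \<mu> \<noteq> {} \<and> - pred_set \<mu> \<noteq> {} \<and>
     pred_set \<mu> \<in> sets borel \<and> - pred_set \<mu> \<in> sets borel"

primrec stl_formula :: "'a::topological_space stl \<Rightarrow> bool" where
  "stl_formula Truth \<longleftrightarrow> True"
| "stl_formula (Pred \<mu>) \<longleftrightarrow> admissible_pred \<mu>"
| "stl_formula (Neg \<phi>) \<longleftrightarrow> stl_formula \<phi>"
| "stl_formula (Conj \<phi>1 \<phi>2) \<longleftrightarrow> stl_formula \<phi>1 \<and> stl_formula \<phi>2"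
| "stl_formula (Until I \<phi>1 \<phi>2) \<longleftrightarrow> time_interval I \<and> stl_formula \<phi>1 \<and> stl_formula \<phi>2"
| "stl_formula (Since I \<phi>1 \<phi>2) \<longleftrightarrow> time_interval I \<and> stl_formula \<phi>1 \<and> stl_formula \<phi>2"

text \<open>The integer points of the real sets \<open>t \<oplus> I\<close> and \<open>t \<ominus> I\<close>.\<close>

definition shift_fwd :: "int \<Rightarrow> real set \<Rightarrow> int set" where
  "shift_fwd t I = {t''. real_of_int t'' \<in> {real_of_int t + s | s. s \<in> I}}"

definition shift_bwd :: "int \<Rightarrow> real set \<Rightarrow> int set" where
  "shift_bwd t I = {t''. real_of_int t'' \<in> {real_of_int t - s | s. s \<in> I}}"

primrec sem :: "'a stl \<Rightarrow> (int \<Rightarrow> 'a) \<Rightarrow> int \<Rightarrow> bool" where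
  "sem Truth x t = True"
| "sem (Pred \<mu>) x t = (if x t \<in> pred_set \<mu> then True else False)"
| "sem (Neg \<phi>) x t = (\<not> sem \<phi> x t)"
| "sem (Conj \<phi>1 \<phi>2) x t = min (sem \<phi>1 x t) (sem \<phi>2 x t)"
| "sem (Until I \<phi>1 \<phi>2) x t =
     (SUP t''\<in>shift_fwd t I. min (sem \<phi>2 x t'') (INF t'\<in>{t<..<t''}. sem \<phi>1 x t'))"
| "sem (Since I \<phi>1 \<phi>2) x t =
     (SUP t''\<in>shift_bwd t I. min (sem \<phi>2 x t'') (INF t'\<in>{t''<..<t}. sem \<phi>1 x t'))"

text \<open>Metrics are allowed to take the value \<open>\<infinity>\<close>.\<close>

definition ext_metric :: "('a \<Rightarrow> 'a \<Rightarrow> ennreal) \<Rightarrow> bool" where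
  "ext_metric d \<longleftrightarrow>
     (\<forall>x y. d x y = 0 \<longleftrightarrow> x = y) \<and>
     (\<forall>x y. d x y = d y x) \<and>
     (\<forall>x y z. d x z \<le> d x y + d y z)"

text \<open>
  For an arbitrary metric \<open>d\<close> on the state space, unrelated to its usual topology, the distance
  to a Borel set need not be a Borel function. The following condition links \<open>d\<close> to the usual
  Borel sets; it holds in particular for every metric inducing the usual topology.
\<close>

definition metric_open :: "('a \<Rightarrow> 'a \<Rightarrow> ennreal) \<Rightarrow> 'a set \<Rightarrow> bool" where
  "metric_open d S \<longleftrightarrow> (\<forall>x\<in>S. \<exists>e>0. \<forall>y. d x y < e \<longrightarrow> y \<in> S)"

definition borel_compatible :: "('a::topological_space \<Rightarrow> 'a \<Rightarrow> ennreal) \<Rightarrow> bool" where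
  "borel_compatible d \<longleftrightarrow> (\<forall>S. metric_open d S \<longrightarrow> S \<in> sets borel)"

lemma ext_metric_dist: "ext_metric (\<lambda>x y :: 'a::metric_space. ennreal (dist x y))"
  unfolding ext_metric_def
  by (auto simp: dist_commute dist_triangle simp flip: ennreal_plus intro!: ennreal_leI)

lemma borel_compatible_dist: "borel_compatible (\<lambda>x y :: 'a::metric_space. ennreal (dist x y))"
proof -
  have "open S" if S: "metric_open (\<lambda>x y :: 'a. ennreal (dist x y)) S" for S
    unfolding open_dist
  proof
    fix x assume "x \<in> S"
    then obtain e where e: "e > 0" "\<And>y. ennreal (dist x y) < e \<Longrightarrow> y \<in> S"
      using S unfolding metric_open_def by blast
    obtain r where r: "0 < r" "ennreal r \<le> e"
    proof (cases e)
      case (real r)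
      then show ?thesis using e(1) that[of r] by auto
    next
      case top
      then show ?thesis using that[of 1] by auto
    qed
    have "y \<in> S" if "dist y x < r" for y
    proof (rule e(2))
      have "ennreal (dist x y) < ennreal r"
        using that r(1) by (simp add: dist_commute ennreal_lessI)
      then show "ennreal (dist x y) < e"
        using r(2) by (rule less_le_trans)
    qed
    then show "\<exists>r>0. \<forall>y. dist y x < r \<longrightarrow> y \<in> S" using r(1) by blast
  qed
  then show ?thesis by (auto simp: borel_compatible_def)
qed

definition set_dist :: "('a \<Rightarrow> 'a \<Rightarrow> ennreal) \<Rightarrow> 'a \<Rightarrow> 'a set \<Rightarrow> ennreal" where
  "set_dist d z S = (INF z'\<in>S. d z z')"

primrec rob :: "('a::topological_space \<Rightarrow> 'a \<Rightarrow> ennreal) \<Rightarrow> 'a stl \<Rightarrow> (int \<Rightarrow> 'a) \<Rightarrow> int \<Rightarrow> ereal" where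
  "rob d Truth x t = \<infinity>"
| "rob d (Pred \<mu>) x t =
     (if x t \<in> pred_set \<mu> then enn2ereal (set_dist d (x t) (closure (- pred_set \<mu>)))
      else - enn2ereal (set_dist d (x t) (closure (pred_set \<mu>))))"
| "rob d (Neg \<phi>) x t = - rob d \<phi> x t"
| "rob d (Conj \<phi>1 \<phi>2) x t = min (rob d \<phi>1 x t) (rob d \<phi>2 x t)"
| "rob d (Until I \<phi>1 \<phi>2) x t =
     (SUP t''\<in>shift_fwd t I. min (rob d \<phi>2 x t'') (INF t'\<in>{t<..<t''}. rob d \<phi>1 x t'))"
| "rob d (Since I \<phi>1 \<phi>2) x t =
     (SUP t''\<in>shift_bwd t I. min (rob d \<phi>2 x t'') (INF t'\<in>{t''<..<t}. rob d \<phi>1 x t'))"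

text \<open>With the discrete \<open>\<sigma>\<close>-algebra on the integers, every function is a signal.\<close>

definition signals :: "(int \<Rightarrow> 'a::topological_space) set" where
  "signals = (count_space UNIV \<rightarrow>\<^sub>M borel)"

definition sig_dist :: "('a \<Rightarrow> 'a \<Rightarrow> ennreal) \<Rightarrow> (int \<Rightarrow> 'a) \<Rightarrow> (int \<Rightarrow> 'a) \<Rightarrow> ennreal" where
  "sig_dist d x x' = (SUP t. d (x t) (x' t))"

definition sig_closure ::
  "('a::topological_space \<Rightarrow> 'a \<Rightarrow> ennreal) \<Rightarrow> (int \<Rightarrow> 'a) set \<Rightarrow> (int \<Rightarrow> 'a) set" where
  "sig_closure d L = {x \<in> signals. \<forall>e>0. \<exists>x'\<in>L. sig_dist d x x' < e}"

definition sat_set :: "'a::topological_space stl \<Rightarrow> int \<Rightarrow> (int \<Rightarrow> 'a) set" where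
  "sat_set \<phi> t = {x \<in> signals. sem \<phi> x t = True}"

definition rob_degree ::
  "('a::topological_space \<Rightarrow> 'a \<Rightarrow> ennreal) \<Rightarrow> 'a stl \<Rightarrow> (int \<Rightarrow> 'a) \<Rightarrow> int \<Rightarrow> ennreal" where
  "rob_degree d \<phi> x t = (INF x'\<in>sig_closure d (sat_set (Neg \<phi>) t). sig_dist d x x')"

definition stochastic_process :: "'w measure \<Rightarrow> (int \<Rightarrow> 'w \<Rightarrow> 'a::topological_space) \<Rightarrow> bool" where
  "stochastic_process M X \<longleftrightarrow> (\<forall>t. X t \<in> M \<rightarrow>\<^sub>M borel)"

end

theory Submission
  imports Defs "HOL-Library.Ramsey"
begin

text \<open>
  Truth and robustness are obtained from Borel functions of the \<open>X s\<close> by countable suprema and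
  infima. The robustness degree is an infimum over uncountably many signals: \<open>RD < a\<close> holds iff for
  some \<open>c < a\<close> in a countable dense set there is a signal \<open>y\<close> violating \<open>\<phi>\<close> at \<open>t\<close> with
  \<open>d (x s) (y s) < c\<close> for all \<open>s\<close>, which a priori is the projection of a Borel set. Since \<open>\<phi>\<close> sees only
  the truth values of finitely many predicates, such a \<open>y\<close> exists iff a finite automaton, whose
  states are sets of subformulas and whose transitions at time \<open>s\<close> depend on which combinations of
  truth values occur within distance \<open>c\<close> of \<open>x s\<close>, has a fair run on the integers. The past and the future of
  \<open>t\<close> separate once the state at \<open>t\<close> is fixed. On a half line, Ramsey's theorem cuts any run into
  segments of types \<open>s, e, e, e, \<dots>\<close>, and whether a fair run exists depends on \<open>(s, e)\<close> only. By a
  merging argument, as in the algebraic proof of McNaughton's theorem, the existence of such cuts is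
  a condition with countable quantifiers over finite segments.
\<close>

subsection \<open>Fair runs of finite automata\<close>

text \<open>
  Two positions \<open>k < m\<close> merge if the types of the segments from \<open>k\<close> and from \<open>m\<close> to some common
  later position agree. A factorization into segments of a fixed type \<open>e\<close>, whose existence is a
  second-order condition, can then be read off from infinitely many positions merging with one.
\<close>

lemma merging_cuts:
  fixes \<tau> :: "nat \<Rightarrow> nat \<Rightarrow> 'c"
  assumes comp: "\<And>k l m. k < l \<Longrightarrow> l < m \<Longrightarrow> \<tau> k m = f (\<tau> k l) (\<tau> l m)"
    and inf: "\<exists>\<^sub>\<infinity>m. k < m \<and> \<tau> k m = e \<and> (\<exists>m'>m. \<tau> k m' = \<tau> m m')"
  obtains c :: "nat \<Rightarrow> nat" where "strict_mono c" "c 0 = k" "\<And>i. \<tau> (c i) (c (Suc i)) = e"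
proof -
  define S where "S m \<longleftrightarrow> k < m \<and> \<tau> k m = e \<and> (\<exists>m'>m. \<tau> k m' = \<tau> m m')" for m
  have inf': "\<exists>m>n. S m" for n
    using inf by (simp add: INFM_nat S_def)
  have step: "\<exists>y>x. S y \<and> \<tau> x y = e" if x: "x = k \<or> S x" for x
    using x
  proof
    assume "x = k"
    then show ?thesis using inf'[of k] by (auto simp: S_def)
  next
    assume "S x"
    then obtain m' where m': "k < x" "m' > x" "\<tau> k m' = \<tau> x m'"
      by (auto simp: S_def)
    obtain y where y: "y > m'" "S y" using inf' by blast
    \<comment> \<open>Both types split at \<open>m'\<close>. There \<open>x\<close> and
      \<open>k\<close> have already merged, and the second factor \<open>\<tau> m' y\<close> is
      shared.\<close>
    have "\<tau> x y = \<tau> k y"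
      using comp[of x m' y] comp[of k m' y] m' y by simp
    moreover have "\<tau> k y = e" using y(2) by (simp add: S_def)
    ultimately show ?thesis using y m' by (intro exI[of _ y]) auto
  qed
  have "\<exists>c. \<forall>n::nat. ((n = 0 \<longrightarrow> c n = k) \<and> (c n = k \<or> S (c n))) \<and> (c n < c (Suc n) \<and> \<tau> (c n) (c (Suc n)) = e)"
  proof (rule dependent_nat_choice)
    fix x and n :: nat
    assume "(n = 0 \<longrightarrow> x = k) \<and> (x = k \<or> S x)"
    then show "\<exists>y. ((Suc n = 0 \<longrightarrow> y = k) \<and> (y = k \<or> S y)) \<and> x < y \<and> \<tau> x y = e"
      using step[of x] by blast
  qed auto
  then show thesis
    using that by (metis strict_mono_Suc_iff)
qed

text \<open>Ramsey's theorem for pairs, where the colour of \<open>{k, m}\<close> is the type of the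
  segment between them, coded as a number through an injection of the finite set \<open>C\<close>.
  \<open>Min\<close> and \<open>Max\<close> recover the order of an unordered pair. Working inside
  the positive naturals leaves room for an initial segment before the first cut.\<close>

lemma homogeneous_cuts:
  fixes \<tau> :: "nat \<Rightarrow> nat \<Rightarrow> 'c"
  assumes fin: "finite C" and C: "\<And>k m. k < m \<Longrightarrow> \<tau> k m \<in> C"
  shows "\<exists>(c :: nat \<Rightarrow> nat) e. strict_mono c \<and> c 0 > 0 \<and> (\<forall>i j. i < j \<longrightarrow> \<tau> (c i) (c j) = e)"
proof -
  obtain g :: "'c \<Rightarrow> nat" and N where g: "inj_on g C" "g ` C = {i. i < N}"
    using finite_imp_inj_to_nat_seg[OF fin] by metis
  define f where "f A = g (\<tau> (Min A) (Max A))" for A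
  have "f {x, y} < N" if "x \<noteq> y" for x y
    using C[of "min x y" "max x y"] that g(2) by (auto simp: f_def min_def max_def split: if_splits)
  then obtain Y t where Y: "infinite Y" "Y \<subseteq> {0<..}" "\<And>x y. x \<in> Y \<Longrightarrow> y \<in> Y \<Longrightarrow> x \<noteq> y \<Longrightarrow> f {x, y} = t"
    using Ramsey2[of "{0::nat<..}" f N] infinite_Ioi by metis
  have in_Y: "enumerate Y i \<in> Y" for i
    using Y(1) by (rule enumerate_in_set)
  have mono: "strict_mono (enumerate Y)"
    using Y(1) by (rule strict_mono_enumerate)
  have lt: "enumerate Y i < enumerate Y j" if "i < j" for i j
    using mono that by (rule strict_monoD)
  have col: "g (\<tau> (enumerate Y i) (enumerate Y j)) = t" if "i < j" for i j
    using Y(3)[OF in_Y in_Y, of i j] lt[OF that] by (simp add: f_def max_def min_def)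
  have "\<tau> (enumerate Y i) (enumerate Y j) = \<tau> (enumerate Y 0) (enumerate Y 1)" if "i < j" for i j
  proof (rule inj_onD[OF g(1)])
    show "g (\<tau> (enumerate Y i) (enumerate Y j)) = g (\<tau> (enumerate Y 0) (enumerate Y 1))"
      unfolding col[OF that] by (rule col[symmetric]) simp
    show "\<tau> (enumerate Y i) (enumerate Y j) \<in> C" by (rule C[OF lt[OF that]])
    show "\<tau> (enumerate Y 0) (enumerate Y 1) \<in> C" by (rule C[OF lt]) simp
  qed
  note hom = this
  have pos: "enumerate Y 0 > 0" using in_Y Y(2) by auto
  show ?thesis
    by (intro exI[of _ "enumerate Y"] exI[of _ "\<tau> (enumerate Y 0) (enumerate Y 1)"] conjI allI impI mono pos hom)
qed

section \<open>Cutting and gluing along a half line\<close>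

lemma cut_interval:
  fixes c :: "nat \<Rightarrow> nat"
  assumes "strict_mono c" "c 0 = 0"
  obtains i where "c i \<le> n" "n < c (Suc i)"
proof -
  have ex: "n < c (Suc n)" using strict_mono_imp_increasing[OF assms(1), of "Suc n"] by simp
  define i where "i = (LEAST i. n < c (Suc i))"
  have 1: "n < c (Suc i)" unfolding i_def using ex by (rule LeastI)
  have 2: "c i \<le> n"
  proof (cases i)
    case (Suc j)
    then have "\<not> n < c (Suc j)" using not_less_Least[of j "\<lambda>i. n < c (Suc i)"] by (simp add: i_def)
    then show ?thesis using Suc by simp
  qed (use assms in simp)
  show thesis using that 1 2 by blast
qed

lemma cut_interval_unique:
  fixes c :: "nat \<Rightarrow> nat"
  assumes "strict_mono c" "c i \<le> n" "n < c (Suc i)" "c j \<le> n" "n < c (Suc j)"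
  shows "i = j"
proof -
  have "c i < c (Suc j)" "c j < c (Suc i)" using assms by linarith+
  then have "i < Suc j" "j < Suc i" using strict_mono_less[OF assms(1)] by blast+
  then show ?thesis by simp
qed

text \<open>Consecutive pieces overlap exactly in one cut, where they agree. The glued function
  takes the value of the right-hand piece at a cut, so the closed interval, and with it the last
  transition of each piece, is respected.\<close>

lemma glue_segments:
  fixes c :: "nat \<Rightarrow> nat"
  assumes c: "strict_mono c" "c 0 = 0"
    and g: "\<And>i. g i (c (Suc i)) = g (Suc i) (c (Suc i))"
  obtains h where "\<And>i n. c i \<le> n \<Longrightarrow> n \<le> c (Suc i) \<Longrightarrow> h n = g i n"
proof -
  have "\<exists>i. c i \<le> n \<and> n < c (Suc i)" for n
    using cut_interval[OF c] by metis
  then obtain idx where idx: "\<And>n. c (idx n) \<le> n" "\<And>n. n < c (Suc (idx n))"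
    by metis
  have *: "idx n = i" if "c i \<le> n" "n < c (Suc i)" for n i
    using cut_interval_unique[OF c(1) idx that] .
  show thesis
  proof (rule that[of "\<lambda>n. g (idx n) n"])
    fix i n assume n: "c i \<le> n" "n \<le> c (Suc i)"
    show "g (idx n) n = g i n"
    proof (cases "n = c (Suc i)")
      case True
      have "idx n = Suc i"
        by (rule *) (use True strict_monoD[OF c(1), of "Suc i" "Suc (Suc i)"] in auto)
      then show ?thesis using g[of i] True by simp
    qed (use n *[of i n] in simp)
  qed
qed

text \<open>The intervals between cuts are finite, so infinitely many positions meet infinitely many
  of them. Conversely \<open>i \<le> c i\<close> pushes the positions to infinity. This lets
  fairness be read off from the segments.\<close>

lemma INFM_cuts:
  fixes c :: "nat \<Rightarrow> nat"
  assumes c: "strict_mono c" "c 0 = 0"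
  shows "(\<exists>\<^sub>\<infinity>n. Q n) \<longleftrightarrow> (\<exists>\<^sub>\<infinity>i. \<exists>n\<in>{c i..<c (Suc i)}. Q n)"
proof
  assume Q: "\<exists>\<^sub>\<infinity>n. Q n"
  show "\<exists>\<^sub>\<infinity>i. \<exists>n\<in>{c i..<c (Suc i)}. Q n"
    unfolding INFM_nat
  proof
    fix m
    obtain n where n: "n > c (Suc m)" "Q n" using Q by (auto simp: INFM_nat)
    obtain i where i: "c i \<le> n" "n < c (Suc i)" using cut_interval[OF c] by metis
    have "c (Suc m) < c (Suc i)" using n i by simp
    then have "m < i" using strict_mono_less[OF c(1)] by simp
    then show "\<exists>i>m. \<exists>n\<in>{c i..<c (Suc i)}. Q n"
      using i n by (intro exI[of _ i] conjI bexI[of _ n]) auto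
  qed
next
  assume R: "\<exists>\<^sub>\<infinity>i. \<exists>n\<in>{c i..<c (Suc i)}. Q n"
  show "\<exists>\<^sub>\<infinity>n. Q n"
    unfolding INFM_nat
  proof
    fix m
    obtain i n where i: "i > m" "c i \<le> n" "Q n"
      using R unfolding INFM_nat by (meson atLeastLessThan_iff)
    have "i \<le> c i" using c(1) by (rule strict_mono_imp_increasing)
    then show "\<exists>n>m. Q n" using i by (intro exI[of _ n]) auto
  qed
qed

section \<open>Segment types and acceptance by fair runs\<close>

text \<open>The set of visited states is all that fairness needs to know about a segment. The end
  state is left out of it, so that consecutive segments partition the positions. Only the values of
  \<open>h\<close> on \<open>{k..m}\<close> matter.\<close>

definition segment_type :: "(nat \<Rightarrow> ('q \<times> 'q) set) \<Rightarrow> nat \<Rightarrow> nat \<Rightarrow> ('q \<times> 'q \<times> 'q set) set" where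
  "segment_type P k m = {(h k, h m, h ` {k..<m}) | h. \<forall>n\<in>{k..<m}. (h n, h (Suc n)) \<in> P n}"

definition concat_type ::
    "('q \<times> 'q \<times> 'q set) set \<Rightarrow> ('q \<times> 'q \<times> 'q set) set \<Rightarrow> ('q \<times> 'q \<times> 'q set) set" where
  "concat_type S T = {(p, r, J \<union> K) | p q r J K. (p, q, J) \<in> S \<and> (q, r, K) \<in> T}"

text \<open>Runs on adjacent segments can be pasted when they agree at the common position. Hence
  types multiply, which is the composition law that \<open>merging_cuts\<close> requires.\<close>

lemma segment_type_concat:
  assumes "k < l" "l < m"
  shows "segment_type P k m = concat_type (segment_type P k l) (segment_type P l m)"
proof (intro set_eqI iffI)
  fix x assume "x \<in> segment_type P k m"
  then obtain h where h: "x = (h k, h m, h ` {k..<m})" "\<forall>n\<in>{k..<m}. (h n, h (Suc n)) \<in> P n"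
    by (auto simp: segment_type_def)
  have "(h k, h l, h ` {k..<l}) \<in> segment_type P k l" "(h l, h m, h ` {l..<m}) \<in> segment_type P l m"
    using h assms unfolding segment_type_def by fastforce+
  moreover have "h ` {k..<m} = h ` {k..<l} \<union> h ` {l..<m}"
    using assms by (simp add: image_Un[symmetric] ivl_disj_un_two)
  ultimately show "x \<in> concat_type (segment_type P k l) (segment_type P l m)"
    unfolding concat_type_def h(1) by blast
next
  fix x assume "x \<in> concat_type (segment_type P k l) (segment_type P l m)"
  then obtain g h where x: "x = (g k, h m, g ` {k..<l} \<union> h ` {l..<m})" and gh: "g l = h l"
    and g: "\<forall>n\<in>{k..<l}. (g n, g (Suc n)) \<in> P n" and h: "\<forall>n\<in>{l..<m}. (h n, h (Suc n)) \<in> P n"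
    by (auto simp: segment_type_def concat_type_def)
  define f where "f n = (if n < l then g n else h n)" for n
  have fg: "f n = g n" if "n \<le> l" for n using that gh by (simp add: f_def)
  have fh: "f n = h n" if "n \<ge> l" for n using that by (simp add: f_def)
  have "(f n, f (Suc n)) \<in> P n" if "n \<in> {k..<m}" for n
    using that g h fg fh by (cases "n < l") auto
  moreover have "f ` {k..<m} = g ` {k..<l} \<union> h ` {l..<m}"
  proof -
    have "f ` {k..<m} = f ` {k..<l} \<union> f ` {l..<m}"
      using assms by (simp add: image_Un[symmetric] ivl_disj_un_two)
    then show ?thesis using fg fh by simp
  qed
  moreover have "f k = g k" "f m = h m" using fg fh assms by auto
  ultimately show "x \<in> segment_type P k m"
    unfolding segment_type_def x by (intro CollectI exI[of _ f]) auto
qed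

lemma segment_type_subset:
  assumes "k < m" and P: "\<And>n. P n \<subseteq> H \<times> H"
  shows "segment_type P k m \<subseteq> H \<times> H \<times> Pow H"
proof
  fix x assume "x \<in> segment_type P k m"
  then obtain h where h: "x = (h k, h m, h ` {k..<m})" "\<forall>n\<in>{k..<m}. (h n, h (Suc n)) \<in> P n"
    by (auto simp: segment_type_def)
  have *: "h n \<in> H" "h (Suc n) \<in> H" if "n \<in> {k..<m}" for n
    using h(2) P that by blast+
  \<comment> \<open>The end state \<open>h m\<close> is the target of the last transition, at
    \<open>m - 1\<close>. Such a transition exists because \<open>k < m\<close>.\<close>
  show "x \<in> H \<times> H \<times> Pow H"
    using h(1) * *(2)[of "m - 1"] assms(1) by auto
qed

text \<open>Generalized Buechi acceptance. The input word is hidden in the dependence of the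
  transition relation on the position.\<close>

definition accepts :: "(nat \<Rightarrow> ('q \<times> 'q) set) \<Rightarrow> 'q set set \<Rightarrow> 'q \<Rightarrow> bool" where
  "accepts P F q \<longleftrightarrow> (\<exists>h. h 0 = q \<and> (\<forall>n. (h n, h (Suc n)) \<in> P n) \<and> (\<forall>B\<in>F. \<exists>\<^sub>\<infinity>n. h n \<in> B))"

text \<open>A fair run on the abstract word \<open>s e e e ...\<close> of types: \<open>p\<close>
  gives the states at the cuts and \<open>J\<close> the states visited between them. It does not
  mention the transition relation, so it becomes a constant when that relation is random.\<close>

definition linked ::
    "'q set set \<Rightarrow> 'q \<Rightarrow> ('q \<times> 'q \<times> 'q set) set \<Rightarrow> ('q \<times> 'q \<times> 'q set) set \<Rightarrow> bool" where
  "linked F q s e \<longleftrightarrow> (\<exists>p J. p 0 = q \<and> (\<forall>i::nat. (p i, p (Suc i), J i) \<in> case_nat s (\<lambda>_. e) i) \<and>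
     (\<forall>B\<in>F. \<exists>\<^sub>\<infinity>i. J i \<inter> B \<noteq> {}))"

text \<open>Ramsey's theorem cuts an accepting run into \<open>s, e, e, ...\<close>, and its cuts
  merge pairwise. Conversely, \<open>merging_cuts\<close> recovers a factorization from the merging
  condition, and local runs realizing the linked triples are glued. The right-hand side quantifies
  only over finite sets and natural numbers.\<close>

lemma accepts_iff_linked:
  assumes fin: "finite H" and P: "\<And>n. P n \<subseteq> H \<times> H"
  shows "accepts P F q \<longleftrightarrow>
    (\<exists>s\<in>Pow (H \<times> H \<times> Pow H). \<exists>e\<in>Pow (H \<times> H \<times> Pow H). linked F q s e \<and>
      (\<exists>k>0. segment_type P 0 k = s \<and> (\<exists>\<^sub>\<infinity>m. k < m \<and> segment_type P k m = e \<and>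
         (\<exists>m'>m. segment_type P k m' = segment_type P m m'))))"
    (is "_ \<longleftrightarrow> ?R")
proof
  let ?\<tau> = "segment_type P"
  have sub: "?\<tau> k m \<in> Pow (H \<times> H \<times> Pow H)" if "k < m" for k m
    using segment_type_subset[OF that P] by simp
  assume "accepts P F q"
  then obtain h where h: "h 0 = q" "\<And>n. (h n, h (Suc n)) \<in> P n" "\<And>B. B \<in> F \<Longrightarrow> \<exists>\<^sub>\<infinity>n. h n \<in> B"
    by (auto simp: accepts_def)
  have "\<exists>(c :: nat \<Rightarrow> nat) e. strict_mono c \<and> c 0 > 0 \<and> (\<forall>i j. i < j \<longrightarrow> ?\<tau> (c i) (c j) = e)"
    by (rule homogeneous_cuts[where C = "Pow (H \<times> H \<times> Pow H)"]) (use fin in simp, rule sub)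
  then obtain c :: "nat \<Rightarrow> nat" and e where
    c: "strict_mono c" "c 0 > 0" and hom: "\<forall>i j. i < j \<longrightarrow> ?\<tau> (c i) (c j) = e"
    by (elim exE conjE)
  have e: "?\<tau> (c i) (c j) = e" if "i < j" for i j
    using hom that by (elim allE impE)
  \<comment> \<open>Prepending the cut 0 makes the segment of type \<open>s\<close> the one with
    index 0.\<close>
  define d where "d = case_nat 0 c"
  have d: "strict_mono d" "d 0 = 0"
    using c by (auto simp: d_def strict_mono_Suc_iff split: nat.split)
  have lt: "c i < c j" if "i < j" for i j
    using c(1) that by (rule strict_monoD)
  show ?R
  proof (intro bexI conjI exI)
    show "c 0 > 0" by (rule c)
    show "?\<tau> 0 (c 0) = ?\<tau> 0 (c 0)" ..
    show "?\<tau> 0 (c 0) \<in> Pow (H \<times> H \<times> Pow H)" "e \<in> Pow (H \<times> H \<times> Pow H)"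
      using sub[OF c(2)] sub[OF lt[of 0 1]] e[of 0 1] by auto
    show "linked F q (?\<tau> 0 (c 0)) e"
      unfolding linked_def
    proof (intro exI conjI allI ballI)
      show "h (d 0) = q" using h d by simp
      fix i
      have "(h (d i), h (d (Suc i)), h ` {d i..<d (Suc i)}) \<in> ?\<tau> (d i) (d (Suc i))"
        using h(2) unfolding segment_type_def by blast
      also have "?\<tau> (d i) (d (Suc i)) = case_nat (?\<tau> 0 (c 0)) (\<lambda>_. e) i"
        using e by (simp add: d_def split: nat.split)
      finally show "(h (d i), h (d (Suc i)), h ` {d i..<d (Suc i)}) \<in> case_nat (?\<tau> 0 (c 0)) (\<lambda>_. e) i" .
    next
      fix B assume "B \<in> F"
      then have "\<exists>\<^sub>\<infinity>i. \<exists>n\<in>{d i..<d (Suc i)}. h n \<in> B"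
        using h(3) INFM_cuts[OF d, of "\<lambda>n. h n \<in> B"] by blast
      then show "\<exists>\<^sub>\<infinity>i. h ` {d i..<d (Suc i)} \<inter> B \<noteq> {}"
        by (rule INFM_mono) auto
    qed
    show "\<exists>\<^sub>\<infinity>m. c 0 < m \<and> ?\<tau> (c 0) m = e \<and> (\<exists>m'>m. ?\<tau> (c 0) m' = ?\<tau> m m')"
      unfolding INFM_nat
    proof
      fix n
      have "n < c (Suc n)" using strict_mono_imp_increasing[OF c(1), of "Suc n"] by simp
      \<comment> \<open>The cuts \<open>c 0\<close> and \<open>c (Suc n)\<close> merge at the next
        cut, since both types up to there equal \<open>e\<close>.\<close>
      moreover have "\<exists>m'>c (Suc n). ?\<tau> (c 0) m' = ?\<tau> (c (Suc n)) m'"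
        using e[of 0 "Suc (Suc n)"] e[of "Suc n" "Suc (Suc n)"] lt by (intro exI[of _ "c (Suc (Suc n))"]) auto
      ultimately show "\<exists>m>n. c 0 < m \<and> ?\<tau> (c 0) m = e \<and> (\<exists>m'>m. ?\<tau> (c 0) m' = ?\<tau> m m')"
        using e[of 0 "Suc n"] lt[of 0 "Suc n"] by blast
    qed
  qed
next
  let ?\<tau> = "segment_type P"
  assume ?R
  then obtain s e k where l: "linked F q s e" and k: "k > 0" "?\<tau> 0 k = s"
    and inf: "\<exists>\<^sub>\<infinity>m. k < m \<and> ?\<tau> k m = e \<and> (\<exists>m'>m. ?\<tau> k m' = ?\<tau> m m')"
    by blast
  obtain c :: "nat \<Rightarrow> nat" where c: "strict_mono c" "c 0 = k" "\<And>i. ?\<tau> (c i) (c (Suc i)) = e"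
    using merging_cuts[OF segment_type_concat inf] by metis
  obtain p J where p: "p 0 = q" "\<And>i::nat. (p i, p (Suc i), J i) \<in> case_nat s (\<lambda>_. e) i"
    "\<And>B. B \<in> F \<Longrightarrow> \<exists>\<^sub>\<infinity>i. J i \<inter> B \<noteq> {}"
    using l unfolding linked_def by blast
  define d where "d = case_nat 0 c"
  have d: "strict_mono d" "d 0 = 0"
    using c k by (auto simp: d_def strict_mono_Suc_iff split: nat.split)
  have "(p i, p (Suc i), J i) \<in> ?\<tau> (d i) (d (Suc i))" for i
    using p(2)[of i] c k by (cases i) (auto simp: d_def)
  then have "\<exists>g. p i = g (d i) \<and> p (Suc i) = g (d (Suc i)) \<and> J i = g ` {d i..<d (Suc i)} \<and>
      (\<forall>n\<in>{d i..<d (Suc i)}. (g n, g (Suc n)) \<in> P n)" for i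
    by (simp add: segment_type_def)
  then obtain g where g: "\<And>i. p i = g i (d i)" "\<And>i. p (Suc i) = g i (d (Suc i))"
      "\<And>i. J i = g i ` {d i..<d (Suc i)}"
      "\<And>i n. n \<in> {d i..<d (Suc i)} \<Longrightarrow> (g i n, g i (Suc n)) \<in> P n"
    by metis
  \<comment> \<open>Neighbouring local runs agree at their common cut, where both have the state
    \<open>p (Suc i)\<close>.\<close>
  obtain h where h: "\<And>i n. d i \<le> n \<Longrightarrow> n \<le> d (Suc i) \<Longrightarrow> h n = g i n"
    using glue_segments[OF d, of g] g(1,2) by metis
  show "accepts P F q"
    unfolding accepts_def
  proof (intro exI conjI allI ballI)
    show "h 0 = q" using h[of 0 0] g(1)[of 0] p(1) d by simp
    fix n
    obtain i where "d i \<le> n" "n < d (Suc i)" using cut_interval[OF d] by metis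
    then show "(h n, h (Suc n)) \<in> P n" using g(4)[of n i] h[of i n] h[of i "Suc n"] by simp
  next
    fix B assume "B \<in> F"
    then have "\<exists>\<^sub>\<infinity>i. J i \<inter> B \<noteq> {}" by (rule p(3))
    then have "\<exists>\<^sub>\<infinity>i. \<exists>n\<in>{d i..<d (Suc i)}. h n \<in> B"
      by (rule INFM_mono) (use h g(3) in fastforce)
    then show "\<exists>\<^sub>\<infinity>n. h n \<in> B" using INFM_cuts[OF d, of "\<lambda>n. h n \<in> B"] by blast
  qed
qed

section \<open>Measurability of acceptance\<close>

text \<open>Restricted to \<open>{k..m}\<close>, the candidate runs form a finite set of functions
  into \<open>H\<close>. The event is then a finite Boolean combination of the events that single
  transitions are allowed.\<close>

lemma pred_segment_type:
  fixes P :: "'w \<Rightarrow> nat \<Rightarrow> ('q \<times> 'q) set"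
  assumes fin: "finite H" and P: "\<And>w n. P w n \<subseteq> H \<times> H"
    and meas: "\<And>n p q. Measurable.pred M (\<lambda>w. (p, q) \<in> P w n)"
    and km: "k < m"
  shows "Measurable.pred M (\<lambda>w. x \<in> segment_type (P w) k m)"
proof -
  obtain p q J where x: "x = (p, q, J)" by (cases x)
  have eq: "x \<in> segment_type (P w) k m \<longleftrightarrow>
     (\<exists>h\<in>PiE {k..m} (\<lambda>_. H). p = h k \<and> q = h m \<and> J = h ` {k..<m} \<and> (\<forall>n\<in>{k..<m}. (h n, h (Suc n)) \<in> P w n))"
    for w
  proof
    assume "x \<in> segment_type (P w) k m"
    then obtain h where h: "p = h k" "q = h m" "J = h ` {k..<m}" "\<forall>n\<in>{k..<m}. (h n, h (Suc n)) \<in> P w n"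
      by (auto simp: segment_type_def x)
    have *: "h n \<in> H" "h (Suc n) \<in> H" if "n \<in> {k..<m}" for n
      using h(4) P[of w n] that by blast+
    have "h n \<in> H" if "n \<in> {k..m}" for n
      using *(1)[of n] *(2)[of "m - 1"] that km by (cases "n = m") auto
    then have "restrict h {k..m} \<in> PiE {k..m} (\<lambda>_. H)" by auto
    moreover have "restrict h {k..m} ` {k..<m} = h ` {k..<m}" by (intro image_cong) auto
    ultimately show "\<exists>h\<in>PiE {k..m} (\<lambda>_. H). p = h k \<and> q = h m \<and> J = h ` {k..<m} \<and> (\<forall>n\<in>{k..<m}. (h n, h (Suc n)) \<in> P w n)"
      using h km by (intro bexI[of _ "restrict h {k..m}"]) auto
  qed (auto simp: segment_type_def x)
  have fin': "finite (PiE {k..m} (\<lambda>_. H))" using fin by (intro finite_PiE) auto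
  have const: "Measurable.pred M (\<lambda>_. b)" for b by simp
  show ?thesis
    unfolding eq
    by (intro pred_intros_finite(3,4) pred_intros_logic(3) meas const fin' finite_atLeastLessThan)
qed

text \<open>Equality is tested on the finitely many possible triples. An \<open>s\<close> that
  leaves this finite set is never attained.\<close>

lemma pred_segment_type_eq:
  fixes P :: "'w \<Rightarrow> nat \<Rightarrow> ('q \<times> 'q) set"
  assumes fin: "finite H" and P: "\<And>w n. P w n \<subseteq> H \<times> H"
    and meas: "\<And>n p q. Measurable.pred M (\<lambda>w. (p, q) \<in> P w n)"
    and km: "k < m"
  shows "Measurable.pred M (\<lambda>w. segment_type (P w) k m = s)"
proof (cases "s \<subseteq> H \<times> H \<times> Pow H")
  case True
  have eq: "segment_type (P w) k m = s \<longleftrightarrow> (\<forall>x\<in>H \<times> H \<times> Pow H. x \<in> segment_type (P w) k m \<longleftrightarrow> x \<in> s)" for w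
  proof -
    have "A = s \<longleftrightarrow> (\<forall>x\<in>U. x \<in> A \<longleftrightarrow> x \<in> s)" if "A \<subseteq> U" "s \<subseteq> U" for A U
      using that by blast
    then show ?thesis using segment_type_subset[OF km, of "P w", OF P] True .
  qed
  have const: "Measurable.pred M (\<lambda>_. b)" for b by simp
  have fin': "finite (H \<times> H \<times> Pow H)" using fin by simp
  show ?thesis
    unfolding eq by (intro pred_intros_finite(3) pred_intros_logic(6) pred_segment_type[OF assms] const fin')
next
  case False
  then have "segment_type (P w) k m \<noteq> s" for w
    using segment_type_subset[OF km, of "P w", OF P] by blast
  then show ?thesis by simp
qed

lemma pred_accepts:
  fixes P :: "'w \<Rightarrow> nat \<Rightarrow> ('q \<times> 'q) set"
  assumes fin: "finite H" and P: "\<And>w n. P w n \<subseteq> H \<times> H"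
    and meas: "\<And>n p q. Measurable.pred M (\<lambda>w. (p, q) \<in> P w n)"
  shows "Measurable.pred M (\<lambda>w. accepts (P w) F q)"
proof -
  let ?T = "Pow (H \<times> H \<times> Pow H)"
  have T: "finite ?T" using fin by simp
  have const: "Measurable.pred M (\<lambda>_. b)" for b by simp
  have eq: "Measurable.pred M (\<lambda>w. segment_type (P w) k m = s)" if "k < m" for k m s
    using pred_segment_type_eq[OF assms that] .
  have merge: "Measurable.pred M (\<lambda>w. segment_type (P w) k n = segment_type (P w) m n)" if "k < n" "m < n" for k m n
  proof -
    \<comment> \<open>Both sides vary with \<open>w\<close>, so they are compared through a common
      value in the finite set of types.\<close>
    have *: "segment_type (P w) k n = segment_type (P w) m n \<longleftrightarrow>
      (\<exists>s\<in>?T. segment_type (P w) k n = s \<and> segment_type (P w) m n = s)" for w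
      using segment_type_subset[OF that(1), of "P w", OF P] by auto
    show ?thesis
      unfolding * by (intro pred_intros_finite(4) pred_intros_logic(3) eq that T)
  qed
  have 1: "Measurable.pred M (\<lambda>w. k < m \<and> segment_type (P w) k m = e \<and>
         (\<exists>m'>m. segment_type (P w) k m' = segment_type (P w) m m'))" for k m e
  proof (cases "k < m")
    case True
    have *: "Measurable.pred M (\<lambda>w. m < n \<and> segment_type (P w) k n = segment_type (P w) m n)" for n
      using merge[of k n m] True by (cases "m < n") simp_all
    show ?thesis by (intro pred_intros_logic(3) pred_intros_countable(2) eq True const *)
  qed simp
  have 2: "Measurable.pred M (\<lambda>w. 0 < k \<and> segment_type (P w) 0 k = s)" for k s
    using eq[of 0 k s] by (cases "0 < k") simp_all
  have 3: "Measurable.pred M (\<lambda>w. \<exists>k>0. segment_type (P w) 0 k = s \<and> (\<exists>\<^sub>\<infinity>m. k < m \<and>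
      segment_type (P w) k m = e \<and> (\<exists>m'>m. segment_type (P w) k m' = segment_type (P w) m m')))" for s e
    unfolding INFM_nat
  proof (rule pred_intros_countable(2))
    fix k
    have "Measurable.pred M (\<lambda>w. (0 < k \<and> segment_type (P w) 0 k = s) \<and> (\<forall>n. \<exists>m>n. k < m \<and>
      segment_type (P w) k m = e \<and> (\<exists>m'>m. segment_type (P w) k m' = segment_type (P w) m m')))"
      by (intro pred_intros_logic(3) pred_intros_countable 2 1 const)
    then show "Measurable.pred M (\<lambda>w. 0 < k \<and> segment_type (P w) 0 k = s \<and> (\<forall>n. \<exists>m>n. k < m \<and>
      segment_type (P w) k m = e \<and> (\<exists>m'>m. segment_type (P w) k m' = segment_type (P w) m m')))"
      by (simp only: conj_assoc)
  qed
  show ?thesis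
    unfolding accepts_iff_linked[OF fin, of "P _", OF P]
    by (intro pred_intros_finite(4) pred_intros_logic(3) 3 T const)
qed

subsection \<open>Temporal formulas over the integers\<close>

text \<open>\<open>True\<close> stands for the future, \<open>False\<close> for the past.\<close>

definition dir :: "bool \<Rightarrow> int" where "dir b = (if b then 1 else -1)"

lemma dir_simps [simp]: "dir True = 1" "dir False = -1" "dir b * dir b = 1"
  by (simp_all add: dir_def)

text \<open>Two half runs with the same state \<open>q\<close> at \<open>t\<close> can be pasted
  there. The past is read backwards with converse relations; its n-th step joins
  \<open>t - n\<close> to \<open>t - n - 1\<close> and hence uses the transition at time
  \<open>t - n - 1\<close>.\<close>

lemma two_sided_run_iff:
  fixes P :: "int \<Rightarrow> ('q \<times> 'q) set"
  shows "(\<exists>h. h t = q \<and> (\<forall>s. (h s, h (s + 1)) \<in> P s) \<and> (\<forall>b. \<forall>B\<in>F b. \<exists>\<^sub>\<infinity>n. h (t + dir b * int n) \<in> B)) \<longleftrightarrow>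
    accepts (\<lambda>n. P (t + int n)) (F True) q \<and> accepts (\<lambda>n. (P (t - int n - 1))\<inverse>) (F False) q"
    (is "?L \<longleftrightarrow> ?R")
proof
  assume ?L
  then obtain h where h: "h t = q" "\<And>s. (h s, h (s + 1)) \<in> P s"
    "\<And>b B. B \<in> F b \<Longrightarrow> \<exists>\<^sub>\<infinity>n. h (t + dir b * int n) \<in> B" by blast
  have "accepts (\<lambda>n. P (t + int n)) (F True) q"
    unfolding accepts_def using h(1) h(2)[of "t + int _"] h(3)[of _ True]
    by (intro exI[of _ "\<lambda>n. h (t + int n)"]) (simp add: ac_simps)
  moreover have "(h (t - int (Suc n)), h (t - int n)) \<in> P (t - int n - 1)" for n
    using h(2)[of "t - int n - 1"] by (simp add: algebra_simps)
  then have "accepts (\<lambda>n. (P (t - int n - 1))\<inverse>) (F False) q"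
    unfolding accepts_def using h(1) h(3)[of _ False]
    by (intro exI[of _ "\<lambda>n. h (t - int n)"]) simp
  ultimately show ?R ..
next
  assume ?R
  then obtain f g where f: "f 0 = q" "\<And>n. (f n, f (Suc n)) \<in> P (t + int n)" "\<And>B. B \<in> F True \<Longrightarrow> \<exists>\<^sub>\<infinity>n. f n \<in> B"
    and g: "g 0 = q" "\<And>n. (g (Suc n), g n) \<in> P (t - int n - 1)" "\<And>B. B \<in> F False \<Longrightarrow> \<exists>\<^sub>\<infinity>n. g n \<in> B"
    unfolding accepts_def by auto
  define h where "h s = (if s \<ge> t then f (nat (s - t)) else g (nat (t - s)))" for s
  have hf: "h (t + int n) = f n" for n by (simp add: h_def)
  have hg: "h (t - int n) = g n" for n using f(1) g(1) by (cases "n = 0") (simp_all add: h_def)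
  have "(h s, h (s + 1)) \<in> P s" for s
  proof (cases "s \<ge> t")
    case True
    then show ?thesis
      using f(2)[of "nat (s - t)"] hf[of "nat (s - t)"] hf[of "Suc (nat (s - t))"] by (simp add: ac_simps)
  next
    case False
    define n where "n = nat (t - s - 1)"
    have s: "s = t - int (Suc n)" "s + 1 = t - int n" "s = t - int n - 1" using False by (simp_all add: n_def)
    show ?thesis
      using g(2)[of n] hg[of n] hg[of "Suc n"] s by metis
  qed
  moreover have "\<exists>\<^sub>\<infinity>n. h (t + dir b * int n) \<in> B" if "B \<in> F b" for b B
    using that f(3) g(3) hf hg by (cases b) simp_all
  ultimately show ?L
    using hf[of 0] f(1) by (intro exI[of _ h]) simp
qed

section \<open>Two-way temporal logic and its tableau automaton\<close>

text \<open>The operators are chosen for their local expansion: \<open>LNext\<close> relates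
  adjacent positions, and the non-strict \<open>LUntil\<close> unfolds through the next position.
  Truth can thus be checked one transition at a time.\<close>

datatype 'a ltl =
    LAtom "'a \<Rightarrow> bool"
  | LNot "'a ltl"
  | LAnd "'a ltl" "'a ltl"
  | LNext bool "'a ltl"
  | LUntil bool "'a ltl" "'a ltl"

primrec ltl_sem :: "'a ltl \<Rightarrow> (int \<Rightarrow> 'a) \<Rightarrow> int \<Rightarrow> bool" where
  "ltl_sem (LAtom \<mu>) x s \<longleftrightarrow> \<mu> (x s)"
| "ltl_sem (LNot \<phi>) x s \<longleftrightarrow> \<not> ltl_sem \<phi> x s"
| "ltl_sem (LAnd \<phi> \<psi>) x s \<longleftrightarrow> ltl_sem \<phi> x s \<and> ltl_sem \<psi> x s"
| "ltl_sem (LNext b \<phi>) x s \<longleftrightarrow> ltl_sem \<phi> x (s + dir b)"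
| "ltl_sem (LUntil b \<phi> \<psi>) x s \<longleftrightarrow>
    (\<exists>n. ltl_sem \<psi> x (s + dir b * int n) \<and> (\<forall>j<n. ltl_sem \<phi> x (s + dir b * int j)))"

primrec subformulas :: "'a ltl \<Rightarrow> 'a ltl set" where
  "subformulas (LAtom \<mu>) = {LAtom \<mu>}"
| "subformulas (LNot \<phi>) = insert (LNot \<phi>) (subformulas \<phi>)"
| "subformulas (LAnd \<phi> \<psi>) = insert (LAnd \<phi> \<psi>) (subformulas \<phi> \<union> subformulas \<psi>)"
| "subformulas (LNext b \<phi>) = insert (LNext b \<phi>) (subformulas \<phi>)"
| "subformulas (LUntil b \<phi> \<psi>) = insert (LUntil b \<phi> \<psi>) (subformulas \<phi> \<union> subformulas \<psi>)"

lemma finite_subformulas: "finite (subformulas \<phi>)"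
  by (induction \<phi>) auto

lemma self_in_subformulas: "\<phi> \<in> subformulas \<phi>"
  by (cases \<phi>) auto

lemma subformulas_closed: "\<psi> \<in> subformulas \<phi> \<Longrightarrow> subformulas \<psi> \<subseteq> subformulas \<phi>"
  by (induction \<phi>) auto

text \<open>The tableau conditions between the states \<open>p\<close> at time s and
  \<open>q\<close> at time s + 1. Future operators are checked at the source and past operators at
  the target; on a two-sided run every position is both.\<close>

definition consistent :: "'a ltl set \<Rightarrow> 'a ltl set \<Rightarrow> 'a ltl set \<Rightarrow> bool" where
  "consistent S p q \<longleftrightarrow>
    (\<forall>\<psi>. LNot \<psi> \<in> S \<longrightarrow> (LNot \<psi> \<in> p \<longleftrightarrow> \<psi> \<notin> p)) \<and>
    (\<forall>\<psi> \<theta>. LAnd \<psi> \<theta> \<in> S \<longrightarrow> (LAnd \<psi> \<theta> \<in> p \<longleftrightarrow> \<psi> \<in> p \<and> \<theta> \<in> p)) \<and>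
    (\<forall>\<psi>. LNext True \<psi> \<in> S \<longrightarrow> (LNext True \<psi> \<in> p \<longleftrightarrow> \<psi> \<in> q)) \<and>
    (\<forall>\<psi>. LNext False \<psi> \<in> S \<longrightarrow> (LNext False \<psi> \<in> q \<longleftrightarrow> \<psi> \<in> p)) \<and>
    (\<forall>\<psi> \<theta>. LUntil True \<psi> \<theta> \<in> S \<longrightarrow> (LUntil True \<psi> \<theta> \<in> p \<longleftrightarrow> \<theta> \<in> p \<or> \<psi> \<in> p \<and> LUntil True \<psi> \<theta> \<in> q)) \<and>
    (\<forall>\<psi> \<theta>. LUntil False \<psi> \<theta> \<in> S \<longrightarrow> (LUntil False \<psi> \<theta> \<in> q \<longleftrightarrow> \<theta> \<in> q \<or> \<psi> \<in> q \<and> LUntil False \<psi> \<theta> \<in> p))"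

text \<open>
  Local consistency alone admits runs that postpone the witness of an until formula forever.
\<close>

definition fair_sets :: "'a ltl set \<Rightarrow> bool \<Rightarrow> 'a ltl set set set" where
  "fair_sets S b = {{p. LUntil b \<psi> \<theta> \<in> p \<longrightarrow> \<theta> \<in> p} | \<psi> \<theta>. LUntil b \<psi> \<theta> \<in> S}"

text \<open>Kept apart from \<open>consistent\<close> because this is the only condition on a state
  that involves the letter read.\<close>

definition labelled :: "'a ltl set \<Rightarrow> 'a \<Rightarrow> 'a ltl set \<Rightarrow> bool" where
  "labelled S z p \<longleftrightarrow> (\<forall>\<mu>. LAtom \<mu> \<in> S \<longrightarrow> (LAtom \<mu> \<in> p \<longleftrightarrow> \<mu> z))"

lemma ltl_sem_LUntil_unfold:
  "ltl_sem (LUntil b \<phi> \<psi>) x s \<longleftrightarrow> ltl_sem \<psi> x s \<or> ltl_sem \<phi> x s \<and> ltl_sem (LUntil b \<phi> \<psi>) x (s + dir b)"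
proof -
  have eq: "s + dir b + dir b * int n = s + dir b * int (Suc n)" for n by (simp add: algebra_simps)
  have split: "(\<exists>n. R n) \<longleftrightarrow> R 0 \<or> (\<exists>n. R (Suc n))" for R by (metis not0_implies_Suc)
  show ?thesis
    unfolding ltl_sem.simps eq by (subst split) (auto simp: All_less_Suc2)
qed

text \<open>The subformulas true along \<open>x\<close> form a fair run: an until formula that holds
  beyond position m has its witness beyond m too, and one that fails there satisfies the fairness
  condition vacuously.\<close>

lemma hintikka_complete:
  fixes \<phi> :: "'a ltl" and x :: "int \<Rightarrow> 'a"
  defines "h \<equiv> \<lambda>s. {\<psi> \<in> subformulas \<phi>. ltl_sem \<psi> x s}"
  shows "consistent (subformulas \<phi>) (h s) (h (s + 1))"
    and "labelled (subformulas \<phi>) (x s) (h s)"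
    and "B \<in> fair_sets (subformulas \<phi>) b \<Longrightarrow> \<exists>\<^sub>\<infinity>n. h (t + dir b * int n) \<in> B"
proof -
  let ?S = "subformulas \<phi>"
  have sub: "\<psi> \<in> ?S" if "\<theta> \<in> ?S" "\<psi> \<in> subformulas \<theta>" for \<psi> \<theta>
    using subformulas_closed that by blast
  note self = self_in_subformulas
  show "consistent ?S (h s) (h (s + 1))"
    unfolding consistent_def h_def
    using ltl_sem_LUntil_unfold[of True _ _ x s] ltl_sem_LUntil_unfold[of False _ _ x "s + 1"]
    by (auto simp: self simp del: ltl_sem.simps(5) intro: sub)
  show "labelled ?S (x s) (h s)"
    unfolding labelled_def h_def by simp
  assume "B \<in> fair_sets ?S b"
  then obtain \<psi> \<theta> where U: "LUntil b \<psi> \<theta> \<in> ?S" and B: "B = {p. LUntil b \<psi> \<theta> \<in> p \<longrightarrow> \<theta> \<in> p}"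
    by (auto simp: fair_sets_def)
  have \<theta>: "\<theta> \<in> ?S" using U by (rule sub) (simp add: self)
  show "\<exists>\<^sub>\<infinity>n. h (t + dir b * int n) \<in> B"
    unfolding INFM_nat
  proof
    fix m
    show "\<exists>n>m. h (t + dir b * int n) \<in> B"
    proof (cases "ltl_sem (LUntil b \<psi> \<theta>) x (t + dir b * int (Suc m))")
      case True
      then obtain k where "ltl_sem \<theta> x (t + dir b * int (Suc m) + dir b * int k)" by auto
      then have "ltl_sem \<theta> x (t + dir b * int (Suc m + k))" by (simp add: algebra_simps)
      then show ?thesis using \<theta> by (intro exI[of _ "Suc m + k"]) (simp add: B h_def)
    next
      case False
      then show ?thesis by (intro exI[of _ "Suc m"]) (simp add: B h_def del: ltl_sem.simps)
    qed
  qed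
qed

text \<open>Induction on the formula. An until formula contained in \<open>h s\<close> but false
  would be carried along forever without a witness, which fairness excludes. A true one is put into
  \<open>h s\<close> by walking back from its witness.\<close>

lemma hintikka_sound:
  assumes con: "\<And>s. consistent (subformulas \<phi>) (h s) (h (s + 1))"
    and lab: "\<And>s. labelled (subformulas \<phi>) (x s) (h s)"
    and fair: "\<And>b B. B \<in> fair_sets (subformulas \<phi>) b \<Longrightarrow> \<exists>\<^sub>\<infinity>n. h (t + dir b * int n) \<in> B"
  shows "\<psi> \<in> subformulas \<phi> \<Longrightarrow> \<psi> \<in> h s \<longleftrightarrow> ltl_sem \<psi> x s"
proof (induction \<psi> arbitrary: s)
  case (LAtom \<mu>)
  then show ?case using lab[of s] by (auto simp: labelled_def)
next
  case (LNot \<psi>)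
  then have "\<psi> \<in> subformulas \<phi>" using subformulas_closed[OF LNot.prems] self_in_subformulas[of \<psi>] by auto
  then show ?case using LNot con[of s] by (simp add: consistent_def)
next
  case (LAnd \<psi> \<theta>)
  then have "\<psi> \<in> subformulas \<phi>" "\<theta> \<in> subformulas \<phi>"
    using subformulas_closed[OF LAnd.prems] self_in_subformulas[of \<psi>] self_in_subformulas[of \<theta>] by auto
  then show ?case using LAnd con[of s] by (simp add: consistent_def)
next
  case (LNext b \<psi>)
  then have "\<psi> \<in> subformulas \<phi>" using subformulas_closed[OF LNext.prems] self_in_subformulas[of \<psi>] by auto
  then show ?case using LNext con[of s] con[of "s - 1"] by (cases b) (simp_all add: consistent_def)
next
  case (LUntil b \<psi> \<theta>)
  let ?U = "LUntil b \<psi> \<theta>"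
  have sub: "\<psi> \<in> subformulas \<phi>" "\<theta> \<in> subformulas \<phi>"
    using subformulas_closed[OF LUntil.prems] self_in_subformulas[of \<psi>] self_in_subformulas[of \<theta>] by auto
  have rec: "?U \<in> h s \<longleftrightarrow> ltl_sem \<theta> x s \<or> ltl_sem \<psi> x s \<and> ?U \<in> h (s + dir b)" for s
    using LUntil.IH(1)[OF sub(1)] LUntil.IH(2)[OF sub(2)] LUntil.prems con[of s] con[of "s - 1"]
    by (cases b) (simp_all add: consistent_def)
  show ?case
  proof
    assume U: "?U \<in> h s"
    show "ltl_sem ?U x s"
    proof (rule ccontr)
      assume neg: "\<not> ltl_sem ?U x s"
      have all: "?U \<in> h (s + dir b * int n) \<and> \<not> ltl_sem ?U x (s + dir b * int n)" for n
      proof (induction n)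
        case (Suc n)
        have eq: "s + dir b * int (Suc n) = s + dir b * int n + dir b" by (simp add: algebra_simps)
        show ?case
          unfolding eq
          using Suc rec[of "s + dir b * int n"] ltl_sem_LUntil_unfold[of b \<psi> \<theta> x "s + dir b * int n"] by blast
      qed (use U neg in simp)
      have "{p. ?U \<in> p \<longrightarrow> \<theta> \<in> p} \<in> fair_sets (subformulas \<phi>) b"
        using LUntil.prems by (auto simp: fair_sets_def)
      \<comment> \<open>Fairness counts positions from \<open>t\<close>, the until formula from
        \<open>s\<close>. Choosing \<open>n\<close> larger than their distance puts the position on
        the right side of \<open>s\<close>, and \<open>m\<close> below is its offset from
        \<open>s\<close>.\<close>
      from fair[OF this] obtain n where n: "n > nat \<bar>s - t\<bar>" "?U \<in> h (t + dir b * int n) \<longrightarrow> \<theta> \<in> h (t + dir b * int n)"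
        by (auto simp: INFM_nat)
      define m where "m = nat (int n - dir b * (s - t))"
      have "t + dir b * int n = s + dir b * int m"
        using n(1) by (cases b) (simp_all add: m_def)
      then have "\<theta> \<in> h (s + dir b * int m)" using n(2) all[of m] by simp
      then have "ltl_sem \<theta> x (s + dir b * int m)" using LUntil.IH(2)[OF sub(2)] by simp
      then show False using all[of m] ltl_sem_LUntil_unfold[of b \<psi> \<theta> x "s + dir b * int m"] by blast
    qed
  next
    assume "ltl_sem ?U x s"
    then obtain n where n: "ltl_sem \<theta> x (s + dir b * int n)" "\<And>j. j < n \<Longrightarrow> ltl_sem \<psi> x (s + dir b * int j)"
      by auto
    \<comment> \<open>Here \<open>k\<close> is the distance to the witness, so the induction runs
      from position \<open>n\<close> back to \<open>s\<close>.\<close>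
    have "?U \<in> h (s + dir b * int (n - k))" if "k \<le> n" for k
      using that
    proof (induction k)
      case 0
      then show ?case using rec[of "s + dir b * int n"] n(1) by simp
    next
      case (Suc k)
      then have eq: "s + dir b * int (n - Suc k) + dir b = s + dir b * int (n - k)"
        by (simp add: of_nat_diff algebra_simps)
      have "?U \<in> h (s + dir b * int (n - k))" "n - Suc k < n" using Suc by simp_all
      then show ?case
        using n(2)[of "n - Suc k"] rec[of "s + dir b * int (n - Suc k)", unfolded eq] by blast
    qed
    from this[of n] show "?U \<in> h s" by simp
  qed
qed

text \<open>The automaton guesses an admissible letter \<open>z\<close> and forgets it. This local
  projection replaces the projection along whole words.\<close>

definition near_transitions :: "('a \<Rightarrow> bool) \<Rightarrow> 'a ltl set \<Rightarrow> ('a ltl set \<times> 'a ltl set) set" where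
  "near_transitions N S = {(p, q). p \<subseteq> S \<and> q \<subseteq> S \<and> consistent S p q \<and> (\<exists>z. N z \<and> labelled S z p)}"

text \<open>The letter at time s enters only the transition at time s. Letters can therefore be
  chosen independently at all times and assembled into one word, whose truth values are those
  recorded by the run.\<close>

lemma ex_word_iff_accepts:
  fixes \<phi> :: "'a ltl" and N :: "int \<Rightarrow> 'a \<Rightarrow> bool"
  defines "S \<equiv> subformulas \<phi>"
  shows "(\<exists>x. (\<forall>s. N s (x s)) \<and> ltl_sem \<phi> x t) \<longleftrightarrow>
    (\<exists>q\<in>Pow S. \<phi> \<in> q \<and> accepts (\<lambda>n. near_transitions (N (t + int n)) S) (fair_sets S True) q \<and>
       accepts (\<lambda>n. (near_transitions (N (t - int n - 1)) S)\<inverse>) (fair_sets S False) q)"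
    (is "?L \<longleftrightarrow> ?R")
proof -
  note two = two_sided_run_iff[of t _ "\<lambda>s. near_transitions (N s) S" "fair_sets S"]
  show ?thesis
  proof
    assume ?L
    then obtain x where x: "\<And>s. N s (x s)" "ltl_sem \<phi> x t" by blast
    define h where "h s = {\<psi> \<in> S. ltl_sem \<psi> x s}" for s
    have h: "consistent S (h s) (h (s + 1))" "labelled S (x s) (h s)"
      "B \<in> fair_sets S b \<Longrightarrow> \<exists>\<^sub>\<infinity>n. h (t + dir b * int n) \<in> B" for s b B
      unfolding h_def S_def by (fact hintikka_complete)+
    have "(h s, h (s + 1)) \<in> near_transitions (N s) S" for s
      using h(1,2) x(1) unfolding near_transitions_def by (auto simp: h_def)
    then have "\<exists>g. g t = h t \<and> (\<forall>s. (g s, g (s + 1)) \<in> near_transitions (N s) S) \<and>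
        (\<forall>b. \<forall>B\<in>fair_sets S b. \<exists>\<^sub>\<infinity>n. g (t + dir b * int n) \<in> B)"
      using h(3) by blast
    moreover have "h t \<in> Pow S" "\<phi> \<in> h t"
      using x(2) self_in_subformulas by (auto simp: h_def S_def)
    ultimately show ?R using two[of "h t"] by blast
  next
    assume ?R
    then obtain q where "\<phi> \<in> q" "accepts (\<lambda>n. near_transitions (N (t + int n)) S) (fair_sets S True) q"
       "accepts (\<lambda>n. (near_transitions (N (t - int n - 1)) S)\<inverse>) (fair_sets S False) q" by blast
    then obtain h where h: "\<phi> \<in> h t" "\<And>s. (h s, h (s + 1)) \<in> near_transitions (N s) S"
      "\<And>b B. B \<in> fair_sets S b \<Longrightarrow> \<exists>\<^sub>\<infinity>n. h (t + dir b * int n) \<in> B"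
      using two[of q] by blast
    then have "\<forall>s. \<exists>z. N s z \<and> labelled S z (h s)"
      by (auto simp: near_transitions_def)
    then obtain x where x: "\<And>s. N s (x s)" "\<And>s. labelled S (x s) (h s)" by metis
    have "consistent S (h s) (h (s + 1))" for s using h(2)[of s] by (simp add: near_transitions_def)
    from hintikka_sound[OF this[unfolded S_def] x(2)[unfolded S_def] h(3)[unfolded S_def] self_in_subformulas]
    have "ltl_sem \<phi> x t" using h(1) by blast
    then show ?L using x(1) by blast
  qed
qed

text \<open>
  The existential quantifier ranges over uncountably many words; this is why a naive argument only
  gives an analytic set.
\<close>

lemma pred_ex_word:
  fixes N :: "'w \<Rightarrow> int \<Rightarrow> 'a \<Rightarrow> bool"
  assumes meas: "\<And>s A. Measurable.pred M (\<lambda>w. \<exists>z\<in>A. N w s z)"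
  shows "Measurable.pred M (\<lambda>w. \<exists>x. (\<forall>s. N w s (x s)) \<and> ltl_sem \<phi> x t)"
proof -
  let ?S = "subformulas \<phi>"
  have fin: "finite (Pow ?S)" using finite_subformulas by simp
  have sub: "near_transitions R ?S \<subseteq> Pow ?S \<times> Pow ?S" for R
    by (auto simp: near_transitions_def)
  then have sub': "(near_transitions R ?S)\<inverse> \<subseteq> Pow ?S \<times> Pow ?S" for R
    by blast
  have m: "Measurable.pred M (\<lambda>w. (p, q) \<in> near_transitions (N w s) ?S)" for p q s
  proof -
    \<comment> \<open>For fixed \<open>p\<close> and \<open>q\<close>, only the existence of an
      admissible letter with the prescribed label depends on \<open>w\<close>.\<close>
    have "(p, q) \<in> near_transitions (N w s) ?S \<longleftrightarrow>
        (p \<subseteq> ?S \<and> q \<subseteq> ?S \<and> consistent ?S p q) \<and> (\<exists>z\<in>{z. labelled ?S z p}. N w s z)" for w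
      by (auto simp: near_transitions_def)
    then show ?thesis using meas[of "{z. labelled ?S z p}" s] by simp
  qed
  have c: "Measurable.pred M (\<lambda>_. b)" for b by simp
  have "Measurable.pred M (\<lambda>w. accepts (\<lambda>n. near_transitions (N w (t + int n)) ?S) (fair_sets ?S True) q)" for q
    by (rule pred_accepts[OF fin sub m])
  moreover have "Measurable.pred M (\<lambda>w. accepts (\<lambda>n. (near_transitions (N w (t - int n - 1)) ?S)\<inverse>) (fair_sets ?S False) q)" for q
    by (rule pred_accepts[OF fin sub']) (simp add: m)
  ultimately show ?thesis
    unfolding ex_word_iff_accepts using fin
    by (intro pred_intros_finite(4) pred_intros_logic(3) c)
qed

subsection \<open>Translation of STL into temporal formulas\<close>

text \<open>With this semantic notion, closure properties replace an explicit translation of STL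
  formulas. One temporal formula has to serve all positions.\<close>

definition expressible :: "((int \<Rightarrow> 'a) \<Rightarrow> int \<Rightarrow> bool) \<Rightarrow> bool" where
  "expressible \<Phi> \<longleftrightarrow> (\<exists>\<psi>. \<forall>x t. ltl_sem \<psi> x t = \<Phi> x t)"

lemma expressible_atom: "expressible (\<lambda>x t. \<mu> (x t))"
  unfolding expressible_def by (rule exI[of _ "LAtom \<mu>"]) simp

lemma expressible_not: "expressible \<Phi> \<Longrightarrow> expressible (\<lambda>x t. \<not> \<Phi> x t)"
  unfolding expressible_def by (metis ltl_sem.simps(2))

lemma expressible_and: "expressible \<Phi> \<Longrightarrow> expressible \<Psi> \<Longrightarrow> expressible (\<lambda>x t. \<Phi> x t \<and> \<Psi> x t)"
  unfolding expressible_def by (metis ltl_sem.simps(3))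

lemma expressible_or: "expressible \<Phi> \<Longrightarrow> expressible \<Psi> \<Longrightarrow> expressible (\<lambda>x t. \<Phi> x t \<or> \<Psi> x t)"
  using expressible_not[OF expressible_and[OF expressible_not expressible_not], of \<Phi> \<Psi>] by simp

lemma expressible_shift:
  assumes "expressible \<Phi>"
  shows "expressible (\<lambda>x t. \<Phi> x (t + dir b * int n))"
proof (induction n)
  case 0
  then show ?case using assms by simp
next
  case (Suc n)
  then obtain \<psi> where \<psi>: "\<And>x t. ltl_sem \<psi> x t = \<Phi> x (t + dir b * int n)" by (auto simp: expressible_def)
  show ?case
    unfolding expressible_def by (rule exI[of _ "LNext b \<psi>"]) (simp add: \<psi> algebra_simps)
qed

lemma expressible_Ball:
  assumes "finite A" "\<And>i. i \<in> A \<Longrightarrow> expressible (\<Phi> i)"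
  shows "expressible (\<lambda>x t. \<forall>i\<in>A. \<Phi> i x t)"
  using assms
proof (induction A)
  case empty
  then show ?case using expressible_atom[of "\<lambda>_. True"] by simp
next
  case (insert i A)
  then show ?case using expressible_and[of "\<Phi> i" "\<lambda>x t. \<forall>i\<in>A. \<Phi> i x t"] by simp
qed

lemma expressible_Bex:
  assumes "finite A" "\<And>i. i \<in> A \<Longrightarrow> expressible (\<Phi> i)"
  shows "expressible (\<lambda>x t. \<exists>i\<in>A. \<Phi> i x t)"
  using expressible_not[OF expressible_Ball[of A "\<lambda>i x t. \<not> \<Phi> i x t"]] assms expressible_not by auto

lemma expressible_LUntil:
  assumes "expressible \<Phi>" "expressible \<Psi>"
  shows "expressible (\<lambda>x t. \<exists>n. \<Psi> x (t + dir b * int n) \<and> (\<forall>j<n. \<Phi> x (t + dir b * int j)))"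
proof -
  obtain \<phi> \<psi> where "\<And>x t. ltl_sem \<phi> x t = \<Phi> x t" "\<And>x t. ltl_sem \<psi> x t = \<Psi> x t"
    using assms by (auto simp: expressible_def)
  then show ?thesis
    unfolding expressible_def by (intro exI[of _ "LUntil b \<phi> \<psi>"]) simp
qed

text \<open>A convex set of naturals is finite or a ray \<open>{a..}\<close>. The finite case is a
  finite disjunction. For a ray with \<open>a > 0\<close>, the non-strict until is started at
  distance \<open>a\<close>, and finitely many conditions guard the positions before it.\<close>

lemma expressible_strict_until:
  fixes N :: "nat set"
  assumes \<Phi>: "expressible \<Phi>" and \<Psi>: "expressible \<Psi>"
    and conv: "\<And>i j k. i \<in> N \<Longrightarrow> k \<in> N \<Longrightarrow> i \<le> j \<Longrightarrow> j \<le> k \<Longrightarrow> j \<in> N"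
  shows "expressible (\<lambda>x t. \<exists>n\<in>N. \<Psi> x (t + dir b * int n) \<and> (\<forall>j\<in>{0<..<n}. \<Phi> x (t + dir b * int j)))"
    (is "expressible ?\<Theta>")
proof -
  define E where "E n = (\<lambda>x t. \<Psi> x (t + dir b * int n) \<and> (\<forall>j\<in>{0<..<n}. \<Phi> x (t + dir b * int j)))" for n
  have E: "expressible (E n)" for n
    unfolding E_def by (intro expressible_and expressible_Ball expressible_shift \<Phi> \<Psi>) simp
  define U where "U a = (\<lambda>x t. \<exists>n\<ge>a. E n x t)" for a
  have U: "expressible (U a)" if "a > 0" for a
  proof -
    \<comment> \<open>The positions \<open>0 < j < n\<close> split at \<open>a\<close>. Positivity
      of \<open>a\<close> keeps the non-strict until from demanding \<open>\<Phi>\<close> at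
      \<open>t\<close> itself.\<close>
    have "U a = (\<lambda>x t. (\<forall>j\<in>{0<..<a}. \<Phi> x (t + dir b * int j)) \<and>
        (\<lambda>x t. \<exists>n. \<Psi> x (t + dir b * int n) \<and> (\<forall>j<n. \<Phi> x (t + dir b * int j))) x (t + dir b * int a))"
    proof (intro ext iffI)
      fix x t assume "U a x t"
      then obtain n where n: "n \<ge> a" "\<Psi> x (t + dir b * int n)" "\<And>j. j \<in> {0<..<n} \<Longrightarrow> \<Phi> x (t + dir b * int j)"
        by (auto simp: U_def E_def)
      have eq: "t + dir b * int a + dir b * int j = t + dir b * int (a + j)" for j by (simp add: algebra_simps)
      show "(\<forall>j\<in>{0<..<a}. \<Phi> x (t + dir b * int j)) \<and>
        (\<exists>n. \<Psi> x (t + dir b * int a + dir b * int n) \<and> (\<forall>j<n. \<Phi> x (t + dir b * int a + dir b * int j)))"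
        unfolding eq
      proof (intro conjI exI[of _ "n - a"] allI impI ballI)
        fix j assume "j < n - a"
        then show "\<Phi> x (t + dir b * int (a + j))" using that by (intro n(3)) auto
      qed (use n in auto)
    next
      fix x t
      have eq: "t + dir b * int a + dir b * int j = t + dir b * int (a + j)" for j by (simp add: algebra_simps)
      assume "(\<forall>j\<in>{0<..<a}. \<Phi> x (t + dir b * int j)) \<and>
        (\<exists>n. \<Psi> x (t + dir b * int a + dir b * int n) \<and> (\<forall>j<n. \<Phi> x (t + dir b * int a + dir b * int j)))"
      then obtain n where n: "\<And>j. j \<in> {0<..<a} \<Longrightarrow> \<Phi> x (t + dir b * int j)" "\<Psi> x (t + dir b * int (a + n))"
          "\<And>j. j < n \<Longrightarrow> \<Phi> x (t + dir b * int (a + j))"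
        unfolding eq by blast
      have "\<Phi> x (t + dir b * int j)" if "j \<in> {0<..<a + n}" for j
        using n(1)[of j] n(3)[of "j - a"] that by (cases "j < a") auto
      then show "U a x t" unfolding U_def E_def using n(2) by (intro exI[of _ "a + n"]) auto
    qed
    moreover have "expressible \<dots>"
      by (intro expressible_and expressible_Ball expressible_shift[of "\<lambda>x t. \<exists>n. \<Psi> x (t + dir b * int n) \<and> (\<forall>j<n. \<Phi> x (t + dir b * int j))"] expressible_LUntil)
         (auto intro: expressible_shift \<Phi> \<Psi>)
    ultimately show ?thesis by simp
  qed
  show ?thesis
  proof (cases "finite N")
    case True
    then show ?thesis using expressible_Bex[of N E] E by (simp add: E_def)
  next
    case False
    define a where "a = (LEAST n. n \<in> N)"
    have "N \<noteq> {}" using False by auto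
    then have a: "a \<in> N" "\<And>n. n \<in> N \<Longrightarrow> a \<le> n"
      unfolding a_def by (auto intro: LeastI Least_le)
    have N: "N = {a..}"
    proof (intro equalityI subsetI)
      fix n assume "n \<in> {a..}"
      moreover obtain k where "k \<in> N" "k \<ge> n"
        using False by (meson finite_nat_set_iff_bounded not_le order_less_imp_le)
      ultimately show "n \<in> N" using conv[OF a(1)] by simp
    qed (use a in auto)
    have \<Theta>: "?\<Theta> = U a"
      by (auto simp: fun_eq_iff N U_def E_def)
    show ?thesis
    proof (cases "a = 0")
      case True
      \<comment> \<open>The witness at distance 0 is split off, which leaves the ray starting at
        1.\<close>
      have "U 0 x t \<longleftrightarrow> E 0 x t \<or> U 1 x t" for x t
        unfolding U_def by (metis One_nat_def Suc_leI le0 neq0_conv)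
      then have "U 0 = (\<lambda>x t. E 0 x t \<or> U 1 x t)" by (simp add: fun_eq_iff)
      then show ?thesis using expressible_or[OF E[of 0] U[of 1]] \<Theta> True by simp
    next
      case False
      then show ?thesis using U \<Theta> by simp
    qed
  qed
qed

lemma time_interval_nat_convex:
  assumes "time_interval I" "real i \<in> I" "real k \<in> I" "i \<le> j" "j \<le> k"
  shows "real j \<in> I"
  using assms unfolding time_interval_def by (auto intro: mem_is_interval_1_I[of I "real i" "real k"])

text \<open>Elements of \<open>I\<close> are nonnegative, so integer offsets from \<open>t\<close>
  are natural numbers. This brings the until into the form of
  \<open>expressible_strict_until\<close>.\<close>

lemma shift_fwd_eq: "time_interval I \<Longrightarrow> shift_fwd t I = (\<lambda>n. t + int n) ` {n. real n \<in> I}"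
proof (intro equalityI subsetI)
  fix s assume I: "time_interval I" and "s \<in> shift_fwd t I"
  then have *: "real_of_int (s - t) \<in> I" by (auto simp: shift_fwd_def)
  then have "s \<ge> t" using I by (auto simp: time_interval_def)
  then show "s \<in> (\<lambda>n. t + int n) ` {n. real n \<in> I}"
    using * by (intro image_eqI[of _ _ "nat (s - t)"]) auto
qed (auto simp: shift_fwd_def)

lemma shift_bwd_eq: "time_interval I \<Longrightarrow> shift_bwd t I = (\<lambda>n. t - int n) ` {n. real n \<in> I}"
proof (intro equalityI subsetI)
  fix s assume I: "time_interval I" and "s \<in> shift_bwd t I"
  then have *: "real_of_int (t - s) \<in> I" by (auto simp: shift_bwd_def)
  then have "t \<ge> s" using I by (auto simp: time_interval_def)
  then show "s \<in> (\<lambda>n. t - int n) ` {n. real n \<in> I}"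
    using * by (intro image_eqI[of _ _ "nat (t - s)"]) auto
qed (auto simp: shift_bwd_def)

lemma min_bool_iff: "min p q \<longleftrightarrow> p \<and> q"
  by (auto simp: min_def)

lemma sem_Until_iff:
  "sem (Until I \<phi>1 \<phi>2) x t \<longleftrightarrow>
    (\<exists>t''\<in>shift_fwd t I. sem \<phi>2 x t'' \<and> (\<forall>t'\<in>{t<..<t''}. sem \<phi>1 x t'))"
  by (simp add: min_bool_iff Bex_def Ball_def)

lemma sem_Since_iff:
  "sem (Since I \<phi>1 \<phi>2) x t \<longleftrightarrow>
    (\<exists>t''\<in>shift_bwd t I. sem \<phi>2 x t'' \<and> (\<forall>t'\<in>{t''<..<t}. sem \<phi>1 x t'))"
  by (simp add: min_bool_iff Bex_def Ball_def)

lemma Ball_between_fwd: "(\<forall>s\<in>{t<..<t + int n}. Q s) \<longleftrightarrow> (\<forall>j\<in>{0<..<n}. Q (t + int j))"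
proof -
  have "\<exists>j\<in>{0<..<n}. s = t + int j" if "s \<in> {t<..<t + int n}" for s
    using that by (intro bexI[of _ "nat (s - t)"]) auto
  then show ?thesis by force
qed

lemma Ball_between_bwd: "(\<forall>s\<in>{t - int n<..<t}. Q s) \<longleftrightarrow> (\<forall>j\<in>{0<..<n}. Q (t - int j))"
proof -
  have "\<exists>j\<in>{0<..<n}. s = t - int j" if "s \<in> {t - int n<..<t}" for s
    using that by (intro bexI[of _ "nat (t - s)"]) auto
  then show ?thesis by force
qed

lemma sem_Until_nat:
  assumes "time_interval I"
  shows "sem (Until I \<phi>1 \<phi>2) x t \<longleftrightarrow> (\<exists>n\<in>{n. real n \<in> I}. sem \<phi>2 x (t + dir True * int n) \<and>
    (\<forall>j\<in>{0<..<n}. sem \<phi>1 x (t + dir True * int j)))"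
proof -
  have "sem (Until I \<phi>1 \<phi>2) x t \<longleftrightarrow> (\<exists>n\<in>{n. real n \<in> I}. sem \<phi>2 x (t + int n) \<and>
      (\<forall>s\<in>{t<..<t + int n}. sem \<phi>1 x s))"
    unfolding sem_Until_iff shift_fwd_eq[OF assms] by blast
  then show ?thesis unfolding Ball_between_fwd dir_simps mult_1_left .
qed

lemma sem_Since_nat:
  assumes "time_interval I"
  shows "sem (Since I \<phi>1 \<phi>2) x t \<longleftrightarrow> (\<exists>n\<in>{n. real n \<in> I}. sem \<phi>2 x (t + dir False * int n) \<and>
    (\<forall>j\<in>{0<..<n}. sem \<phi>1 x (t + dir False * int j)))"
proof -
  have "sem (Since I \<phi>1 \<phi>2) x t \<longleftrightarrow> (\<exists>n\<in>{n. real n \<in> I}. sem \<phi>2 x (t - int n) \<and>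
      (\<forall>s\<in>{t - int n<..<t}. sem \<phi>1 x s))"
    unfolding sem_Since_iff shift_bwd_eq[OF assms] by blast
  then show ?thesis unfolding Ball_between_bwd by (simp only: dir_simps mult_minus1 add_uminus_conv_diff)
qed

lemma expressible_sem: "stl_formula \<phi> \<Longrightarrow> expressible (sem \<phi>)"
proof (induction \<phi>)
  case Truth
  then show ?case using expressible_atom[of "\<lambda>_. True"] by simp
next
  case (Pred \<mu>)
  then show ?case using expressible_atom[of \<mu>] by (simp add: pred_set_def)
next
  case (Neg \<phi>)
  then show ?case using expressible_not[of "sem \<phi>"] by simp
next
  case (Conj \<phi>1 \<phi>2)
  then show ?case using expressible_and[of "sem \<phi>1" "sem \<phi>2"] by (simp add: min_bool_iff)
next
  case (Until I \<phi>1 \<phi>2)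
  then have I: "time_interval I" by simp
  have conv: "j \<in> {n. real n \<in> I}" if "i \<in> {n. real n \<in> I}" "k \<in> {n. real n \<in> I}" "i \<le> j" "j \<le> k" for i j k
    using time_interval_nat_convex[OF I] that by blast
  have "expressible (sem \<phi>1)" "expressible (sem \<phi>2)" using Until by simp_all
  from expressible_strict_until[OF this conv, where b = True]
  show ?case unfolding sem_Until_nat[OF I, symmetric] .
next
  case (Since I \<phi>1 \<phi>2)
  then have I: "time_interval I" by simp
  have conv: "j \<in> {n. real n \<in> I}" if "i \<in> {n. real n \<in> I}" "k \<in> {n. real n \<in> I}" "i \<le> j" "j \<le> k" for i j k
    using time_interval_nat_convex[OF I] that by blast
  have "expressible (sem \<phi>1)" "expressible (sem \<phi>2)" using Since by simp_all
  from expressible_strict_until[OF this conv, where b = False]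
  show ?case unfolding sem_Since_nat[OF I, symmetric] .
qed

subsection \<open>Measurability of the semantics\<close>

text \<open>A union of \<open>d\<close>-balls is \<open>d\<close>-open by the triangle inequality,
  for any set \<open>A\<close> of centres. Compatibility turns this into a Borel set.\<close>

lemma sets_ex_near:
  fixes d :: "'a::topological_space \<Rightarrow> 'a \<Rightarrow> ennreal"
  assumes d: "ext_metric d" "borel_compatible d"
  shows "{y. \<exists>z\<in>A. d y z < c} \<in> sets borel"
proof -
  have "metric_open d {y. \<exists>z\<in>A. d y z < c}"
    unfolding metric_open_def
  proof
    fix y assume "y \<in> {y. \<exists>z\<in>A. d y z < c}"
    then obtain z where z: "z \<in> A" "d y z < c" by blast
    have "y' \<in> {y. \<exists>z\<in>A. d y z < c}" if "d y y' < c - d y z" for y'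
    proof -
      \<comment> \<open>Finiteness of \<open>d y z\<close> allows the subtraction in the radius
        \<open>c - d y z\<close> to be undone.\<close>
      have "d y z < top" using z(2) by (rule less_le_trans) simp
      then have "d y y' + d y z < c"
        using that less_diff_eq_ennreal[of c "d y z" "d y y'"] by simp
      moreover have "d y' z \<le> d y y' + d y z" using d(1) unfolding ext_metric_def by metis
      ultimately show ?thesis using z(1) by (auto intro: le_less_trans)
    qed
    then show "\<exists>e>0. \<forall>y'. d y y' < e \<longrightarrow> y' \<in> {y. \<exists>z\<in>A. d y z < c}"
      using diff_gr0_ennreal[OF z(2)] by blast
  qed
  then show ?thesis using d(2) by (simp add: borel_compatible_def)
qed

lemma borel_measurable_set_dist:
  fixes d :: "'a::topological_space \<Rightarrow> 'a \<Rightarrow> ennreal"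
  assumes "ext_metric d" "borel_compatible d"
  shows "(\<lambda>z. set_dist d z S) \<in> borel_measurable borel"
  by (rule borel_measurableI_less) (simp add: set_dist_def INF_less_iff sets_ex_near[OF assms])

text \<open>Time is countable, so the quantifiers in the until operators are countable unions and
  intersections.\<close>

lemma pred_sem:
  assumes X: "stochastic_process M X"
  shows "stl_formula \<phi> \<Longrightarrow> Measurable.pred M (\<lambda>\<omega>. sem \<phi> (\<lambda>s. X s \<omega>) t)"
proof (induction \<phi> arbitrary: t)
  case (Pred \<mu>)
  have [measurable]: "X t \<in> M \<rightarrow>\<^sub>M borel" using X by (simp add: stochastic_process_def)
  have [measurable]: "pred_set \<mu> \<in> sets borel" using Pred by (simp add: admissible_pred_def)
  show ?case by simp
next
  case (Conj \<phi>1 \<phi>2)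
  show ?case unfolding sem.simps min_bool_iff using Conj by (intro pred_intros_logic(3)) auto
next
  case (Until I \<phi>1 \<phi>2)
  then show ?case
    unfolding sem_Until_iff by (intro pred_intros_countable_bounded(3,4) pred_intros_logic(3)) auto
next
  case (Since I \<phi>1 \<phi>2)
  then show ?case
    unfolding sem_Since_iff by (intro pred_intros_countable_bounded(3,4) pred_intros_logic(3)) auto
qed simp_all

lemma borel_measurable_rob:
  assumes X: "stochastic_process M X" and d: "ext_metric d" "borel_compatible d"
  shows "stl_formula \<phi> \<Longrightarrow> (\<lambda>\<omega>. rob d \<phi> (\<lambda>s. X s \<omega>) t) \<in> borel_measurable M"
proof (induction \<phi> arbitrary: t)
  case (Pred \<mu>)
  have [measurable]: "X t \<in> M \<rightarrow>\<^sub>M borel" using X by (simp add: stochastic_process_def)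
  have [measurable]: "pred_set \<mu> \<in> sets borel" using Pred by (simp add: admissible_pred_def)
  note [measurable] = borel_measurable_set_dist[OF d]
  show ?case by simp
next
  case (Conj \<phi>1 \<phi>2)
  then show ?case by simp
next
  case (Until I \<phi>1 \<phi>2)
  then show ?case unfolding rob.simps
    by (intro borel_measurable_SUP borel_measurable_INF borel_measurable_min) auto
next
  case (Since I \<phi>1 \<phi>2)
  then show ?case unfolding rob.simps
    by (intro borel_measurable_SUP borel_measurable_INF borel_measurable_min) auto
qed simp_all

section \<open>The robustness degree as a countable infimum\<close>

lemma sig_dist_triangle:
  assumes "ext_metric d"
  shows "sig_dist d x z \<le> sig_dist d x y + sig_dist d y z"
  unfolding sig_dist_def
proof (rule SUP_least)
  fix t
  have "d (x t) (z t) \<le> d (x t) (y t) + d (y t) (z t)"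
    using assms by (simp add: ext_metric_def)
  also have "\<dots> \<le> (SUP t. d (x t) (y t)) + (SUP t. d (y t) (z t))"
    by (intro add_mono SUP_upper UNIV_I)
  finally show "d (x t) (z t) \<le> (SUP t. d (x t) (y t)) + (SUP t. d (y t) (z t))" .
qed

text \<open>Passing to the closure does not change the distance to a set: a point of the closure is
  approximated within any \<open>e\<close>, at a cost of at most \<open>e\<close> by the triangle
  inequality.\<close>

lemma rob_degree_eq_INF:
  assumes d: "ext_metric d"
  shows "rob_degree d \<phi> x t = (INF y\<in>{y. \<not> sem \<phi> y t}. sig_dist d x y)"
proof -
  define L where "L = {y. \<not> sem \<phi> y t}"
  have signals: "signals = UNIV" by (auto simp: signals_def)
  have L: "sat_set (Neg \<phi>) t = L" by (simp add: sat_set_def signals L_def)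
  have "d z z = 0" for z using d by (simp add: ext_metric_def)
  then have refl: "sig_dist d y y = 0" for y by (simp add: sig_dist_def)
  have "(INF y\<in>sig_closure d L. sig_dist d x y) = (INF y\<in>L. sig_dist d x y)"
  proof (rule antisym)
    show "(INF y\<in>sig_closure d L. sig_dist d x y) \<le> (INF y\<in>L. sig_dist d x y)"
    proof (rule INF_superset_mono)
      show "L \<subseteq> sig_closure d L"
        unfolding sig_closure_def signals using refl by (auto intro!: bexI)
    qed simp
    show "(INF y\<in>L. sig_dist d x y) \<le> (INF y\<in>sig_closure d L. sig_dist d x y)"
    proof (rule INF_greatest)
      fix y assume y: "y \<in> sig_closure d L"
      show "(INF y\<in>L. sig_dist d x y) \<le> sig_dist d x y"
      proof (rule ennreal_le_epsilon)
        fix e :: real assume "0 < e"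
        then have "0 < ennreal e" by simp
        then obtain z where z: "z \<in> L" "sig_dist d y z < ennreal e"
          using y unfolding sig_closure_def by blast
        have "(INF y\<in>L. sig_dist d x y) \<le> sig_dist d x z" using z(1) by (rule INF_lower)
        also have "\<dots> \<le> sig_dist d x y + sig_dist d y z" by (rule sig_dist_triangle[OF d])
        also have "\<dots> \<le> sig_dist d x y + ennreal e" using z(2) by (intro add_left_mono less_imp_le)
        finally show "(INF y\<in>L. sig_dist d x y) \<le> sig_dist d x y + ennreal e" .
      qed
    qed
  qed
  then show ?thesis by (simp add: rob_degree_def L L_def)
qed

text \<open>The pointwise strict bound gives only \<open>sig_dist d x y \<le> c\<close>, which
  suffices for the infimum. Conversely, density provides a \<open>c\<close> strictly between
  \<open>sig_dist d x y\<close> and any larger \<open>a\<close>. The value \<open>top\<close> is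
  neutral for the infimum. The condition on \<open>y\<close> now treats each time separately, as
  \<open>pred_ex_word\<close> demands.\<close>

lemma rob_degree_eq_INF_dense:
  assumes d: "ext_metric d"
    and D: "\<And>U. open U \<Longrightarrow> U \<noteq> {} \<Longrightarrow> \<exists>c\<in>D. c \<in> U"
  shows "rob_degree d \<phi> x t =
    (INF c\<in>D. if \<exists>y. (\<forall>s. d (x s) (y s) < c) \<and> \<not> sem \<phi> y t then c else top)"
    (is "_ = ?R")
  unfolding rob_degree_eq_INF[OF d]
proof (rule antisym)
  show "(INF y\<in>{y. \<not> sem \<phi> y t}. sig_dist d x y) \<le> ?R"
  proof (rule INF_greatest)
    fix c
    show "(INF y\<in>{y. \<not> sem \<phi> y t}. sig_dist d x y)
        \<le> (if \<exists>y. (\<forall>s. d (x s) (y s) < c) \<and> \<not> sem \<phi> y t then c else top)"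
    proof (cases "\<exists>y. (\<forall>s. d (x s) (y s) < c) \<and> \<not> sem \<phi> y t")
      case True
      then obtain y where y: "\<And>s. d (x s) (y s) < c" "\<not> sem \<phi> y t" by blast
      have "(INF y\<in>{y. \<not> sem \<phi> y t}. sig_dist d x y) \<le> sig_dist d x y"
        using y(2) by (intro INF_lower) simp
      also have "\<dots> \<le> c"
        unfolding sig_dist_def using y(1) by (intro SUP_least less_imp_le)
      finally show ?thesis using True by simp
    qed (simp only: if_False top_greatest)
  qed
  show "?R \<le> (INF y\<in>{y. \<not> sem \<phi> y t}. sig_dist d x y)"
  proof (rule dense_ge)
    fix a assume "(INF y\<in>{y. \<not> sem \<phi> y t}. sig_dist d x y) < a"
    then obtain y where y: "\<not> sem \<phi> y t" "sig_dist d x y < a" by (auto simp: INF_less_iff)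
    have "{sig_dist d x y<..<a} \<noteq> {}" using dense[OF y(2)] by auto
    from D[OF open_greaterThanLessThan this] obtain c where c: "c \<in> D" "sig_dist d x y < c" "c < a" by auto
    have "d (x s) (y s) < c" for s
      using c(2) unfolding sig_dist_def by (rule le_less_trans[OF SUP_upper[OF UNIV_I]])
    then have "(if \<exists>y. (\<forall>s. d (x s) (y s) < c) \<and> \<not> sem \<phi> y t then c else top) \<le> a"
      using y(1) c(3) by auto
    then show "?R \<le> a" by (rule INF_lower2[OF c(1)])
  qed
qed

text \<open>For fixed \<open>c\<close>, the existence of a violating signal near the path is an
  instance of \<open>pred_ex_word\<close>, with the negation of \<open>\<phi>\<close> as temporal
  formula and nearness as the constraint on letters. What remains is an infimum over a countable
  set.\<close>

lemma borel_measurable_rob_degree: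
  assumes X: "stochastic_process M X" and d: "ext_metric d" "borel_compatible d" and \<phi>: "stl_formula \<phi>"
  shows "(\<lambda>\<omega>. rob_degree d \<phi> (\<lambda>s. X s \<omega>) t) \<in> borel_measurable M"
proof -
  obtain D :: "ennreal set" where D: "countable D" "\<And>U. open U \<Longrightarrow> U \<noteq> {} \<Longrightarrow> \<exists>c\<in>D. c \<in> U"
    using countable_dense_setE by blast
  obtain \<psi> where \<psi>: "\<And>x t. ltl_sem \<psi> x t \<longleftrightarrow> \<not> sem \<phi> x t"
    using expressible_not[OF expressible_sem[OF \<phi>]] by (auto simp: expressible_def)
  have "Measurable.pred M (\<lambda>\<omega>. \<exists>z\<in>A. d (X s \<omega>) z < c)" for A s c
  proof -
    have "X s \<in> M \<rightarrow>\<^sub>M borel" using X by (simp add: stochastic_process_def)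
    from measurable_sets[OF this sets_ex_near[OF d]] show ?thesis
      by (simp add: pred_def vimage_def Int_def conj_commute)
  qed
  then have [measurable]: "Measurable.pred M (\<lambda>\<omega>. \<exists>y. (\<forall>s. d (X s \<omega>) (y s) < c) \<and> \<not> sem \<phi> y t)" for c
    using pred_ex_word[where N = "\<lambda>\<omega> s z. d (X s \<omega>) z < c" and M = M and \<phi> = \<psi> and t = t] by (simp add: \<psi>)
  have eq: "rob_degree d \<phi> x t =
      (INF c\<in>D. if \<exists>y. (\<forall>s. d (x s) (y s) < c) \<and> \<not> sem \<phi> y t then c else top)" for x
    using d(1) D(2) by (rule rob_degree_eq_INF_dense)
  show ?thesis
    unfolding eq by (intro borel_measurable_INF D(1) measurable_If) measurable
qed

theorem theorem1:
  fixes M :: "'w measure"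
    and X :: "int \<Rightarrow> 'w \<Rightarrow> real ^ 'n"
    and d :: "real ^ 'n \<Rightarrow> real ^ 'n \<Rightarrow> ennreal"
    and \<phi> :: "(real ^ 'n) stl"
    and t :: int
  assumes "prob_space M"
    and "stochastic_process M X"
    and "ext_metric d"
    and "borel_compatible d"
    and "stl_formula \<phi>"
  shows "(\<lambda>\<omega>. sem \<phi> (\<lambda>s. X s \<omega>) t) \<in> M \<rightarrow>\<^sub>M count_space UNIV \<and>
         (\<lambda>\<omega>. enn2ereal (rob_degree d \<phi> (\<lambda>s. X s \<omega>) t)) \<in> M \<rightarrow>\<^sub>M borel \<and>
         (\<lambda>\<omega>. rob d \<phi> (\<lambda>s. X s \<omega>) t) \<in> M \<rightarrow>\<^sub>M borel"
  using pred_sem[OF assms(2,5)] borel_measurable_rob_degree[OF assms(2-5)] borel_measurable_rob[OF assms(2-5)]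
  by simp

end
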